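(* Let $(\mathrm U_q(\mathfrak q),\mathrm U_q(\mathfrak k))\supseteq(\mathrm U_q(\mathfrak p),\mathrm U_q(\mathfrak l))$ be compatible pairs of quantum sub-superalgebras of $\mathrm U_q(\mathfrak{gl}_{m|n})$. For all $W$ in $\mathcal C(\mathfrak q,\mathfrak k)$ and $V$ in $\mathcal C(\mathfrak p,\mathfrak l)$ there exists the natural even isomorphism of $\mathbb Z_2$-graded vector spaces $$\mathrm{Hom}_{\mathrm U_q(\mathfrak q)}\left(W,\mathrm I_{\mathfrak p,\mathfrak l}^{\mathfrak q,\mathfrak k}(V)\right)\xrightarrow{\ \sim\ }\mathrm{Hom}_{\mathrm U_q(\mathfrak p)}\left(\mathcal F_{\mathfrak q,\mathfrak k}^{\mathfrak p,\mathfrak l}(W),V\right),\qquad \phi\mapsto\phi(1),$$ where $\phi(1)$ is the map $w\mapsto\langle\phi(w),1\rangle$ (evaluation at the identity of $\mathrm U_q(\mathfrak q)$) and $\mathcal F_{\mathfrak q,\mathfrak k}^{\mathfrak p,\mathfrak l}:\mathcal C(\mathfrak q,\mathfrak k)\to\mathcal C(\mathfrak p,\mathfrak l)$ is the forgetful functor.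
   Context: **Algebra.** Let $m,n$ be positive integers, $\mathbf I=\{1,\dots,m+n\}$, $\mathbf I'=\{1,\dots,m+n-1\}$, $\mathfrak g=\mathfrak{gl}_{m|n}$ (complex), $\mathfrak h$ the diagonal Cartan subalgebra, $\{\epsilon_a\}$ the basis of $\mathfrak h^*$ dual to the diagonal matrix units, with $(\epsilon_a,\epsilon_b)=\delta_{ab}$ for $a\le m$ and $-\delta_{ab}$ for $a>m$; $\mathfrak h^*_{\mathbb Z}=\bigoplus_a\mathbb Z\epsilon_a$. Let $q$ be an indeterminate, $q_a=q$ for $a\le m$, $q_a=q^{-1}$ for $a>m$. $[x]\in\mathbb Z_2$ denotes parity. $\mathrm U_q(\mathfrak g)$ is the unital associative superalgebra over $\mathbb C(q)$ generated by $E_{a,a+1},E_{a+1,a}$ ($a\in\mathbf I'$), $K_b^{\pm1}$ ($b\in\mathbf I$), with $E_{m,m+1},E_{m+1,m}$ odd and the other generators even, and relations (whenever indices make sense): $K_aK_a^{-1}=1$, the $K_a^{\pm1}$ commute; $K_aE_{b,b\pm1}K_a^{-1}=q^{(\epsilon_a,\epsilon_b-\epsilon_{b\pm1})}E_{b,b\pm1}$; $E_{a,a+1}E_{b+1,b}-(-1)^{\delta_{am}\delta_{bm}}E_{b+1,b}E_{a,a+1}=\delta_{ab}\frac{K_aK_{a+1}^{-1}-K_a^{-1}K_{a+1}}{q_a-q_a^{-1}}$; $E_{m,m+1}^2=E_{m+1,m}^2=0$; $E_{a,a+1}E_{b,b+1}=E_{b,b+1}E_{a,a+1}$ and $E_{a+1,a}E_{b+1,b}=E_{b+1,b}E_{a+1,a}$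 for $|a-b|\ge2$; for $a\ne m$, $x^2y-(q+q^{-1})xyx+yx^2=0$ for $(x,y)=(E_{a,a+1},E_{a\pm1,a+1\pm1})$ and $(E_{a+1,a},E_{a+1\pm1,a\pm1})$; $E_{m-1,m+2}E_{m,m+1}+E_{m,m+1}E_{m-1,m+2}=0=E_{m+2,m-1}E_{m+1,m}+E_{m+1,m}E_{m+2,m-1}$, where for $a<c<b$ $E_{ab}=E_{ac}E_{cb}-q_c^{-1}E_{cb}E_{ac}$, $E_{ba}=E_{bc}E_{ca}-q_cE_{ca}E_{bc}$ (independent of $c$). It is a Hopf superalgebra with $\Delta(E_{a,a+1})=E_{a,a+1}\otimes K_aK_{a+1}^{-1}+1\otimes E_{a,a+1}$, $\Delta(E_{a+1,a})=E_{a+1,a}\otimes1+K_a^{-1}K_{a+1}\otimes E_{a+1,a}$, $\Delta(K_a^{\pm1})=K_a^{\pm1}\otimes K_a^{\pm1}$ and the corresponding counit and antipode. **Sub-superalgebras.** For $\Theta_\pm\subseteq\mathbf I'$ one has the quantum sub-superalgebra generated by all $K_b^{\pm1}$, the $E_{a,a+1}$ with $a\in\Theta_+$ and the $E_{a+1,a}$ with $a\in\Theta_-$. It is reductive if $\Theta_+=\Theta_-$, parabolic if $\Theta_+=\mathbf I'$ or $\Theta_-=\mathbf I'$. A pair $(\mathrm U_q(\mathfrak q),\mathrm U_q(\mathfrak k))$ consists of a parabolic or reductive $\mathrm U_q(\mathfrak q)$ and a reductive $\mathrm U_q(\mathfrak k)\subseteq\mathrm U_q(\mathfrak q)$. Pairs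 are compatible, $(\mathrm U_q(\mathfrak q),\mathrm U_q(\mathfrak k))\supseteq(\mathrm U_q(\mathfrak p),\mathrm U_q(\mathfrak l))$, if $\mathrm U_q(\mathfrak q)\supseteq\mathrm U_q(\mathfrak p)$ and $\mathrm U_q(\mathfrak k)\supseteq\mathrm U_q(\mathfrak l)$. **Modules and functors.** All modules are $\mathbb Z_2$-graded. $\mathrm{Hom}_{\mathrm U}(V,W)$ is the $\mathbb Z_2$-graded space of linear maps with $\phi(xv)=(-1)^{[x][\phi]}x\phi(v)$. An integral weight vector of weight $\mu\in\mathfrak h^*_{\mathbb Z}$ is $v$ with $K_av=q^{(\mu,\epsilon_a)}v$ for all $a$. For a pair, $\mathcal C(\mathfrak q,\mathfrak k)$ is the category, with even morphisms, of $\mathrm U_q(\mathfrak q)$-modules spanned by integral weight vectors $v$ with $\dim\mathrm U_q(\mathfrak k)v<\infty$ (called $\mathrm U_q(\mathfrak k)$-finite). For compatible pairs, the induction functor $\mathrm I_{\mathfrak p,\mathfrak l}^{\mathfrak q,\mathfrak k}:\mathcal C(\mathfrak p,\mathfrak l)\to\mathcal C(\mathfrak q,\mathfrak k)$ sends $V$ to the sum of all $\mathrm U_q(\mathfrak k)$-finite graded $\mathrm U_q(\mathfrak q)$-submodules of $\mathrm{Hom}_{\mathrm U_q(\mathfrak p)}(\mathrm U_q(\mathfrak q),V)$, where $\langle y\zeta,x\rangle=(-1)^{[y]([x]+[\zeta])}\langle\zeta,xy\rangle$, and acts on morphisms by post-composition. *)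

theory Defs
  imports
    Complex_Main
    "HOL-Library.Cardinality"
    "HOL-Library.Z2"
    "HOL-Library.Poly_Mapping"
    "HOL-Library.Function_Algebras"
    "HOL-Computational_Algebra.Polynomial"
    "HOL-Computational_Algebra.Fraction_Field"
begin

section \<open>The ground field and the weight lattice\<close>

type_synonym cq = "complex poly fract"

definition qq :: cq where
  "qq = Fraction_Field.Fract [:0, 1:] 1"

text \<open>Throughout, \<open>m = CARD('m)\<close> and \<open>n = CARD('n)\<close>; these are arbitrary positive integers.
  A weight \<open>\<mu>\<close> stands for the sum of the \<open>\<mu> a \<epsilon>\<^sub>a\<close>, \<open>1 \<le> a \<le> m + n\<close>; the values of
  \<open>\<mu>\<close> at other arguments are irrelevant.\<close>

definition wform :: "nat \<Rightarrow> nat \<Rightarrow> (nat \<Rightarrow> int) \<Rightarrow> (nat \<Rightarrow> int) \<Rightarrow> int" where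
  "wform m n \<mu> \<nu> = (\<Sum>a = 1..m + n. (if a \<le> m then 1 else - 1) * \<mu> a * \<nu> a)"

definition eps :: "nat \<Rightarrow> nat \<Rightarrow> int" where
  "eps a b = (if a = b then 1 else 0)"

definition qa :: "nat \<Rightarrow> nat \<Rightarrow> cq" where
  "qa m a = (if a \<le> m then qq else inverse qq)"


section \<open>The free superalgebra on the generators\<close>

text \<open>\<open>GenE a\<close> is \<open>E\<^bsub>a,a+1\<^esub>\<close> and \<open>GenF a\<close> is \<open>E\<^bsub>a+1,a\<^esub>\<close>.\<close>

datatype raw_gen = GenE nat | GenF nat | GenK nat | GenKinv nat

fun gen_ok :: "nat \<Rightarrow> raw_gen \<Rightarrow> bool" where
  "gen_ok N (GenE a) \<longleftrightarrow> a \<in> {1..N - 1}"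
| "gen_ok N (GenF a) \<longleftrightarrow> a \<in> {1..N - 1}"
| "gen_ok N (GenK b) \<longleftrightarrow> b \<in> {1..N}"
| "gen_ok N (GenKinv b) \<longleftrightarrow> b \<in> {1..N}"

fun raw_parity :: "nat \<Rightarrow> raw_gen \<Rightarrow> bit" where
  "raw_parity m (GenE a) = (if a = m then 1 else 0)"
| "raw_parity m (GenF a) = (if a = m then 1 else 0)"
| "raw_parity m (GenK b) = 0"
| "raw_parity m (GenKinv b) = 0"

typedef ('m::finite, 'n::finite) gen = "{g. gen_ok (CARD('m) + CARD('n)) g}"
proof
  show "GenK 1 \<in> {g. gen_ok (CARD('m) + CARD('n)) g}"
    by (simp add: Suc_le_eq)
qed

datatype 'a word = Word (letters: "'a list")

instantiation word :: (type) monoid_add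
begin
definition zero_word :: "'a word" where "zero_word = Word []"
definition plus_word :: "'a word \<Rightarrow> 'a word \<Rightarrow> 'a word" where
  "plus_word v w = Word (letters v @ letters w)"
instance by standard (auto simp: zero_word_def plus_word_def)
end

text \<open>The monoid algebra of the free monoid: the product of \<open>poly_mapping\<close> is convolution with
  respect to \<open>+\<close> on the keys, which on words is concatenation.\<close>

type_synonym ('m, 'n) falg = "('m, 'n) gen word \<Rightarrow>\<^sub>0 cq"

definition cst :: "cq \<Rightarrow> ('m::finite, 'n::finite) falg" where
  "cst c = Poly_Mapping.single 0 c"

definition letter :: "raw_gen \<Rightarrow> ('m::finite, 'n::finite) falg" where
  "letter g = Poly_Mapping.single (Word [Abs_gen g]) 1"

abbreviation fE :: "nat \<Rightarrow> ('m::finite, 'n::finite) falg" where "fE a \<equiv> letter (GenE a)"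
abbreviation fF :: "nat \<Rightarrow> ('m::finite, 'n::finite) falg" where "fF a \<equiv> letter (GenF a)"
abbreviation fK :: "nat \<Rightarrow> ('m::finite, 'n::finite) falg" where "fK b \<equiv> letter (GenK b)"
abbreviation fKinv :: "nat \<Rightarrow> ('m::finite, 'n::finite) falg" where "fKinv b \<equiv> letter (GenKinv b)"

definition word_parity :: "('m::finite, 'n::finite) gen word \<Rightarrow> bit" where
  "word_parity w = (\<Sum>g\<leftarrow>letters w. raw_parity CARD('m) (Rep_gen g))"


section \<open>The defining relations\<close>

text \<open>\<open>root_vec a b x\<close>: the element \<open>x\<close> is an expression for \<open>E\<^bsub>ab\<^esub>\<close>, for some choice of the
  intermediate indices \<open>c\<close>. Different choices agree in the quotient.\<close>

inductive root_vec :: "nat \<Rightarrow> nat \<Rightarrow> ('m::finite, 'n::finite) falg \<Rightarrow> bool" where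
  "root_vec a (a + 1) (fE a)"
| "root_vec (a + 1) a (fF a)"
| "a < c \<Longrightarrow> c < b \<Longrightarrow> root_vec a c x \<Longrightarrow> root_vec c b y \<Longrightarrow>
     root_vec a b (x * y - cst (inverse (qa CARD('m) c)) * y * x)"
| "a < c \<Longrightarrow> c < b \<Longrightarrow> root_vec b c x \<Longrightarrow> root_vec c a y \<Longrightarrow>
     root_vec b a (x * y - cst (qa CARD('m) c) * y * x)"

definition serre :: "('m::finite, 'n::finite) falg \<Rightarrow> ('m, 'n) falg \<Rightarrow> ('m, 'n) falg" where
  "serre x y = x * x * y - cst (qq + inverse qq) * x * y * x + y * x * x"

inductive uq_rel :: "('m::finite, 'n::finite) falg \<Rightarrow> ('m, 'n) falg \<Rightarrow> bool" where
  K_inv: "b \<in> {1..CARD('m) + CARD('n)} \<Longrightarrow> uq_rel (fK b * fKinv b) 1"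
| K_K: "a \<in> {1..CARD('m) + CARD('n)} \<Longrightarrow> b \<in> {1..CARD('m) + CARD('n)} \<Longrightarrow>
     x \<in> {fK a, fKinv a} \<Longrightarrow> y \<in> {fK b, fKinv b} \<Longrightarrow> uq_rel (x * y) (y * x)"
| K_E: "a \<in> {1..CARD('m) + CARD('n)} \<Longrightarrow> b \<in> {1..CARD('m) + CARD('n) - 1} \<Longrightarrow>
     uq_rel (fK a * fE b * fKinv a)
       (cst (qq powi wform CARD('m) CARD('n) (eps a) (\<lambda>c. eps b c - eps (b + 1) c)) * fE b)"
| K_F: "a \<in> {1..CARD('m) + CARD('n)} \<Longrightarrow> b \<in> {1..CARD('m) + CARD('n) - 1} \<Longrightarrow>
     uq_rel (fK a * fF b * fKinv a)
       (cst (qq powi wform CARD('m) CARD('n) (eps a) (\<lambda>c. eps (b + 1) c - eps b c)) * fF b)"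
| E_F: "a \<in> {1..CARD('m) + CARD('n) - 1} \<Longrightarrow> b \<in> {1..CARD('m) + CARD('n) - 1} \<Longrightarrow>
     uq_rel (fE a * fF b - (if a = CARD('m) \<and> b = CARD('m) then - 1 else 1) * (fF b * fE a))
       (if a = b
        then cst (inverse (qa CARD('m) a - inverse (qa CARD('m) a)))
               * (fK a * fKinv (a + 1) - fKinv a * fK (a + 1))
        else 0)"
| E_odd: "uq_rel (fE CARD('m) * fE CARD('m)) 0"
| F_odd: "uq_rel (fF CARD('m) * fF CARD('m)) 0"
| E_E: "a \<in> {1..CARD('m) + CARD('n) - 1} \<Longrightarrow> b \<in> {1..CARD('m) + CARD('n) - 1} \<Longrightarrow>
     a + 2 \<le> b \<or> b + 2 \<le> a \<Longrightarrow> uq_rel (fE a * fE b) (fE b * fE a)"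
| F_F: "a \<in> {1..CARD('m) + CARD('n) - 1} \<Longrightarrow> b \<in> {1..CARD('m) + CARD('n) - 1} \<Longrightarrow>
     a + 2 \<le> b \<or> b + 2 \<le> a \<Longrightarrow> uq_rel (fF a * fF b) (fF b * fF a)"
| serre_E: "a \<in> {1..CARD('m) + CARD('n) - 1} \<Longrightarrow> b \<in> {1..CARD('m) + CARD('n) - 1} \<Longrightarrow>
     a \<noteq> CARD('m) \<Longrightarrow> b = a + 1 \<or> a = b + 1 \<Longrightarrow> uq_rel (serre (fE a) (fE b)) 0"
| serre_F: "a \<in> {1..CARD('m) + CARD('n) - 1} \<Longrightarrow> b \<in> {1..CARD('m) + CARD('n) - 1} \<Longrightarrow>
     a \<noteq> CARD('m) \<Longrightarrow> b = a + 1 \<or> a = b + 1 \<Longrightarrow> uq_rel (serre (fF a) (fF b)) 0"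
| odd_E: "CARD('m) \<ge> 2 \<Longrightarrow> CARD('n) \<ge> 2 \<Longrightarrow> root_vec (CARD('m) - 1) (CARD('m) + 2) x \<Longrightarrow>
     uq_rel (x * fE CARD('m) + fE CARD('m) * x) 0"
| odd_F: "CARD('m) \<ge> 2 \<Longrightarrow> CARD('n) \<ge> 2 \<Longrightarrow> root_vec (CARD('m) + 2) (CARD('m) - 1) x \<Longrightarrow>
     uq_rel (x * fF CARD('m) + fF CARD('m) * x) 0"

text \<open>The least algebra congruence containing the relations; compatibility with scalars is
  compatibility with multiplication by the central elements \<open>cst c\<close>.\<close>

inductive uq_cong :: "('m::finite, 'n::finite) falg \<Rightarrow> ('m, 'n) falg \<Rightarrow> bool" where
  rel: "uq_rel x y \<Longrightarrow> uq_cong x y"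
| refl: "uq_cong x x"
| sym: "uq_cong x y \<Longrightarrow> uq_cong y x"
| trans: "uq_cong x y \<Longrightarrow> uq_cong y z \<Longrightarrow> uq_cong x z"
| add: "uq_cong x y \<Longrightarrow> uq_cong x' y' \<Longrightarrow> uq_cong (x + x') (y + y')"
| mult: "uq_cong x y \<Longrightarrow> uq_cong x' y' \<Longrightarrow> uq_cong (x * x') (y * y')"


section \<open>The quantum general linear superalgebra\<close>

quotient_type ('m, 'n) uq = "('m::finite, 'n::finite) gen word \<Rightarrow>\<^sub>0 cq" / uq_cong
  by (rule equivpI) (auto simp: reflp_def symp_def transp_def intro: uq_cong.intros)

instantiation uq :: (finite, finite) "{ring, monoid_mult}"
begin

lift_definition zero_uq :: "('a, 'b) uq" is 0 .
lift_definition one_uq :: "('a, 'b) uq" is 1 .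
lift_definition plus_uq :: "('a, 'b) uq \<Rightarrow> ('a, 'b) uq \<Rightarrow> ('a, 'b) uq" is "(+)"
  by (rule uq_cong.add)
lift_definition times_uq :: "('a, 'b) uq \<Rightarrow> ('a, 'b) uq \<Rightarrow> ('a, 'b) uq" is "(*)"
  by (rule uq_cong.mult)
lift_definition uminus_uq :: "('a, 'b) uq \<Rightarrow> ('a, 'b) uq" is uminus
  using uq_cong.mult[OF uq_cong.refl[of "- 1"]] by force
lift_definition minus_uq :: "('a, 'b) uq \<Rightarrow> ('a, 'b) uq \<Rightarrow> ('a, 'b) uq" is "(-)"
proof -
  fix x y x' y' :: "('a, 'b) falg"
  assume "uq_cong x y" "uq_cong x' y'"
  then have "uq_cong (x + - 1 * x') (y + - 1 * y')"
    by (intro uq_cong.add uq_cong.mult uq_cong.refl)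
  then show "uq_cong (x - x') (y - y')" by simp
qed

instance
  by standard (transfer; simp add: algebra_simps uq_cong.refl)+

end

lift_definition uq_scale :: "cq \<Rightarrow> ('m::finite, 'n::finite) uq \<Rightarrow> ('m, 'n) uq"
  is "\<lambda>c x. cst c * x"
  by (intro uq_cong.mult uq_cong.refl)

lift_definition uE :: "nat \<Rightarrow> ('m::finite, 'n::finite) uq" is fE .
lift_definition uF :: "nat \<Rightarrow> ('m::finite, 'n::finite) uq" is fF .
lift_definition uK :: "nat \<Rightarrow> ('m::finite, 'n::finite) uq" is fK .
lift_definition uKinv :: "nat \<Rightarrow> ('m::finite, 'n::finite) uq" is fKinv .

text \<open>The homogeneous component of the given parity.\<close>

definition uq_gr :: "bit \<Rightarrow> ('m::finite, 'n::finite) uq set" where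
  "uq_gr p = abs_uq ` {x. \<forall>w \<in> Poly_Mapping.keys x. word_parity w = p}"


section \<open>Quantum sub-superalgebras\<close>

inductive_set uq_sub :: "nat set \<Rightarrow> nat set \<Rightarrow> ('m::finite, 'n::finite) uq set"
  for Tp Tm :: "nat set" where
  "b \<in> {1..CARD('m) + CARD('n)} \<Longrightarrow> uK b \<in> uq_sub Tp Tm"
| "b \<in> {1..CARD('m) + CARD('n)} \<Longrightarrow> uKinv b \<in> uq_sub Tp Tm"
| "a \<in> Tp \<Longrightarrow> uE a \<in> uq_sub Tp Tm"
| "a \<in> Tm \<Longrightarrow> uF a \<in> uq_sub Tp Tm"
| "1 \<in> uq_sub Tp Tm"
| "x \<in> uq_sub Tp Tm \<Longrightarrow> uq_scale c x \<in> uq_sub Tp Tm"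
| "x \<in> uq_sub Tp Tm \<Longrightarrow> y \<in> uq_sub Tp Tm \<Longrightarrow> x + y \<in> uq_sub Tp Tm"
| "x \<in> uq_sub Tp Tm \<Longrightarrow> y \<in> uq_sub Tp Tm \<Longrightarrow> x * y \<in> uq_sub Tp Tm"

definition reductive :: "('m::finite, 'n::finite) uq set \<Rightarrow> bool" where
  "reductive A \<longleftrightarrow> (\<exists>T \<subseteq> {1..CARD('m) + CARD('n) - 1}. A = uq_sub T T)"

definition parabolic :: "('m::finite, 'n::finite) uq set \<Rightarrow> bool" where
  "parabolic A \<longleftrightarrow> (let I' = {1..CARD('m) + CARD('n) - 1} in
     \<exists>T \<subseteq> I'. A = uq_sub I' T \<or> A = uq_sub T I')"

definition quantum_pair :: "('m::finite, 'n::finite) uq set \<Rightarrow> ('m, 'n) uq set \<Rightarrow> bool" where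
  "quantum_pair Q K \<longleftrightarrow> (parabolic Q \<or> reductive Q) \<and> reductive K \<and> K \<subseteq> Q"

definition compatible_pairs ::
  "('m::finite, 'n::finite) uq set \<Rightarrow> ('m, 'n) uq set \<Rightarrow> ('m, 'n) uq set \<Rightarrow> ('m, 'n) uq set \<Rightarrow> bool"
where
  "compatible_pairs Q K P L \<longleftrightarrow>
     quantum_pair Q K \<and> quantum_pair P L \<and> P \<subseteq> Q \<and> L \<subseteq> K"


section \<open>Graded spaces and graded modules\<close>

text \<open>A graded vector space is given by its two homogeneous components, which are independent
  subspaces of an ambient vector space; the space itself is their sum \<open>gtotal\<close>.\<close>

definition gtotal :: "(bit \<Rightarrow> 'v::ab_group_add set) \<Rightarrow> 'v set" where
  "gtotal G = {u + v | u v. u \<in> G 0 \<and> v \<in> G 1}"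

definition gproj :: "(bit \<Rightarrow> 'v::ab_group_add set) \<Rightarrow> bit \<Rightarrow> 'v \<Rightarrow> 'v" where
  "gproj G p v = (THE u. u \<in> G p \<and> v - u \<in> G (p + 1))"

text \<open>\<open>(-1)\<^sup>p v\<close>\<close>

definition ksign :: "bit \<Rightarrow> 'v::ab_group_add \<Rightarrow> 'v" where
  "ksign p v = (if p = 0 then v else - v)"

record ('m::finite, 'n::finite, 'v) supermod =
  gr :: "bit \<Rightarrow> 'v set"
  smul :: "cq \<Rightarrow> 'v \<Rightarrow> 'v"
  act :: "('m, 'n) uq \<Rightarrow> 'v \<Rightarrow> 'v"

abbreviation carr :: "('m::finite, 'n::finite, 'v::ab_group_add) supermod \<Rightarrow> 'v set" where
  "carr V \<equiv> gtotal (gr V)"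

locale supermodule = vector_space "smul V"
  for A :: "('m::finite, 'n::finite) uq set"
  and V :: "('m, 'n, 'v::ab_group_add) supermod" +
  assumes gr_subspace: "subspace (gr V p)"
    and gr_independent: "gr V 0 \<inter> gr V 1 = {0}"
    and act_gr: "x \<in> A \<inter> uq_gr i \<Longrightarrow> v \<in> gr V j \<Longrightarrow> act V x v \<in> gr V (i + j)"
    and act_add_right: "x \<in> A \<Longrightarrow> v \<in> carr V \<Longrightarrow> w \<in> carr V \<Longrightarrow>
          act V x (v + w) = act V x v + act V x w"
    and act_smul_right: "x \<in> A \<Longrightarrow> v \<in> carr V \<Longrightarrow> act V x (smul V c v) = smul V c (act V x v)"
    and act_add_left: "x \<in> A \<Longrightarrow> y \<in> A \<Longrightarrow> v \<in> carr V \<Longrightarrow>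
          act V (x + y) v = act V x v + act V y v"
    and act_scale_left: "x \<in> A \<Longrightarrow> v \<in> carr V \<Longrightarrow> act V (uq_scale c x) v = smul V c (act V x v)"
    and act_mult: "x \<in> A \<Longrightarrow> y \<in> A \<Longrightarrow> v \<in> carr V \<Longrightarrow> act V (x * y) v = act V x (act V y v)"
    and act_one: "v \<in> carr V \<Longrightarrow> act V 1 v = v"

text \<open>The homogeneous components of \<open>Hom\<^sub>A(V, W)\<close>. A map on the carrier of \<open>V\<close> is represented by the
  function on the ambient type that vanishes outside the carrier.\<close>

definition hom_gr ::
  "('m::finite, 'n::finite) uq set \<Rightarrow> ('m, 'n, 'v::ab_group_add) supermod \<Rightarrow>
   ('m, 'n, 'w::ab_group_add) supermod \<Rightarrow> bit \<Rightarrow> ('v \<Rightarrow> 'w) set"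
where
  "hom_gr A V W p = {\<phi>.
     (\<forall>u \<in> carr V. \<forall>v \<in> carr V. \<phi> (u + v) = \<phi> u + \<phi> v) \<and>
     (\<forall>c. \<forall>v \<in> carr V. \<phi> (smul V c v) = smul W c (\<phi> v)) \<and>
     (\<forall>j. \<phi> ` gr V j \<subseteq> gr W (p + j)) \<and>
     (\<forall>i. \<forall>x \<in> A \<inter> uq_gr i. \<forall>v \<in> carr V. \<phi> (act V x v) = ksign (i * p) (act W x (\<phi> v))) \<and>
     (\<forall>v. v \<notin> carr V \<longrightarrow> \<phi> v = 0)}"

definition hom_smul ::
  "('m::finite, 'n::finite, 'w::ab_group_add) supermod \<Rightarrow> cq \<Rightarrow> ('v \<Rightarrow> 'w) \<Rightarrow> 'v \<Rightarrow> 'w"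
where
  "hom_smul W c \<phi> = (\<lambda>v. smul W c (\<phi> v))"

definition even_iso ::
  "(cq \<Rightarrow> 'v::ab_group_add \<Rightarrow> 'v) \<Rightarrow> (bit \<Rightarrow> 'v set) \<Rightarrow>
   (cq \<Rightarrow> 'w::ab_group_add \<Rightarrow> 'w) \<Rightarrow> (bit \<Rightarrow> 'w set) \<Rightarrow> ('v \<Rightarrow> 'w) \<Rightarrow> bool"
where
  "even_iso s G t H f \<longleftrightarrow>
     (\<forall>u \<in> gtotal G. \<forall>v \<in> gtotal G. f (u + v) = f u + f v) \<and>
     (\<forall>c. \<forall>v \<in> gtotal G. f (s c v) = t c (f v)) \<and>
     (\<forall>p. f ` G p \<subseteq> H p) \<and>
     bij_betw f (gtotal G) (gtotal H)"


section \<open>The categories, the forgetful functor and the induction functor\<close>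

definition weight_vector ::
  "('m::finite, 'n::finite, 'v::ab_group_add) supermod \<Rightarrow> (nat \<Rightarrow> int) \<Rightarrow> 'v \<Rightarrow> bool"
where
  "weight_vector V \<mu> v \<longleftrightarrow> v \<in> carr V \<and>
     (\<forall>a \<in> {1..CARD('m) + CARD('n)}.
        act V (uK a) v = smul V (qq powi wform CARD('m) CARD('n) \<mu> (eps a)) v)"

text \<open>Membership in \<open>C(q, k)\<close>; since \<open>{act V x v | x. x \<in> K}\<close> is a subspace, the condition on \<open>B\<close>
  says that it is finite-dimensional.\<close>

definition in_cat ::
  "('m::finite, 'n::finite) uq set \<Rightarrow> ('m, 'n) uq set \<Rightarrow>
   ('m, 'n, 'v::ab_group_add) supermod \<Rightarrow> bool"
where
  "in_cat Q K V \<longleftrightarrow> supermodule Q V \<and>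
     carr V = module.span (smul V)
       {v. (\<exists>\<mu>. weight_vector V \<mu> v) \<and>
           (\<exists>B. finite B \<and> {act V x v | x. x \<in> K} = module.span (smul V) B)}"

definition forget ::
  "('m::finite, 'n::finite) uq set \<Rightarrow> ('m, 'n, 'v::ab_group_add) supermod \<Rightarrow>
   ('m, 'n, 'v) supermod"
where
  "forget P W = W\<lparr>act := \<lambda>x w. if x \<in> P then act W x w else 0\<rparr>"

definition regular_mod :: "('m::finite, 'n::finite) uq set \<Rightarrow> ('m, 'n, ('m, 'n) uq) supermod" where
  "regular_mod Q = \<lparr>gr = \<lambda>p. Q \<inter> uq_gr p, smul = uq_scale, act = (*)\<rparr>"

text \<open>\<open>Hom\<^sub>P(Q, V)\<close> with \<open>\<langle>y\<zeta>, x\<rangle> = (-1)\<^bsup>[y]([x]+[\<zeta>])\<^esup> \<langle>\<zeta>, xy\<rangle>\<close> on homogeneous elements; below, \<open>i\<close>, \<open>j\<close>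
  and \<open>k\<close> are the parities of the components of \<open>y\<close>, \<open>x\<close> and \<open>\<zeta>\<close>.\<close>

definition coind ::
  "('m::finite, 'n::finite) uq set \<Rightarrow> ('m, 'n) uq set \<Rightarrow> ('m, 'n, 'v::ab_group_add) supermod \<Rightarrow>
   ('m, 'n, ('m, 'n) uq \<Rightarrow> 'v) supermod"
where
  "coind Q P V = (let H = hom_gr P (regular_mod Q) V in
     \<lparr>gr = H,
      smul = hom_smul V,
      act = \<lambda>y \<zeta> x.
        if x \<in> Q
        then \<Sum>i \<in> {0, 1}. \<Sum>j \<in> {0, 1}. \<Sum>k \<in> {0, 1}.
               ksign (i * (j + k)) (gproj H k \<zeta> (gproj uq_gr j x * gproj uq_gr i y))
        else 0\<rparr>)"

definition graded_submodule ::
  "('m::finite, 'n::finite) uq set \<Rightarrow> ('m, 'n, 'v::ab_group_add) supermod \<Rightarrow> 'v set \<Rightarrow> bool"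
where
  "graded_submodule A M S \<longleftrightarrow>
     module.subspace (smul M) S \<and>
     S = gtotal (\<lambda>p. gr M p \<inter> S) \<and>
     (\<forall>x \<in> A. \<forall>v \<in> S. act M x v \<in> S)"

definition sub_mod ::
  "('m::finite, 'n::finite, 'v::ab_group_add) supermod \<Rightarrow> 'v set \<Rightarrow> ('m, 'n, 'v) supermod"
where
  "sub_mod M S = M\<lparr>gr := \<lambda>p. gr M p \<inter> S\<rparr>"

text \<open>The sum of a family of subspaces is the span of their union. The graded submodules in the
  family are those which are themselves objects of \<open>C(q, k)\<close>.\<close>

definition ind ::
  "('m::finite, 'n::finite) uq set \<Rightarrow> ('m, 'n) uq set \<Rightarrow> ('m, 'n) uq set \<Rightarrow>
   ('m, 'n, 'v::ab_group_add) supermod \<Rightarrow> ('m, 'n, ('m, 'n) uq \<Rightarrow> 'v) supermod"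
where
  "ind Q K P V = (let M = coind Q P V in
     sub_mod M (module.span (smul M)
       (\<Union>{S. graded_submodule Q M S \<and> in_cat Q K (sub_mod M S)})))"

definition ind_map ::
  "('m::finite, 'n::finite) uq set \<Rightarrow> ('m, 'n) uq set \<Rightarrow> ('m, 'n) uq set \<Rightarrow>
   ('m, 'n, 'v::ab_group_add) supermod \<Rightarrow> ('v \<Rightarrow> 'w::ab_group_add) \<Rightarrow>
   (('m, 'n) uq \<Rightarrow> 'v) \<Rightarrow> ('m, 'n) uq \<Rightarrow> 'w"
where
  "ind_map Q K P V g = (\<lambda>\<zeta>. if \<zeta> \<in> carr (ind Q K P V) then g \<circ> \<zeta> else 0)"

definition eval_one :: "('w \<Rightarrow> ('m::finite, 'n::finite) uq \<Rightarrow> 'v) \<Rightarrow> 'w \<Rightarrow> 'v" where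
  "eval_one \<phi> = (\<lambda>w. \<phi> w 1)"

end

theory Submission
  imports Defs
begin

text \<open>A homomorphism \<open>\<phi>\<close> into the coinduced module is recovered from \<open>\<psi> = \<phi>(1)\<close> by
  \<open>\<langle>\<phi>(w), x\<rangle> = (-1)\<^bsup>[x][w]\<^esup> \<psi>(xw)\<close>, and this formula defines a homomorphism for every \<open>\<psi>\<close>; this is
  Frobenius reciprocity for the full coinduced module. Weight vectors and finite-dimensionality are
  inherited by homomorphic images, so the image of an object of \<open>C(q, k)\<close> is one of the
  submodules whose sum is the induced module, and nothing changes when the target is cut down to it.
  The signs make sense because the defining relations are homogeneous: the parity automorphism of
  the free superalgebra descends to the quotient and preserves the sub-superalgebras.\<close>

text \<open>The obstacle is that signs make sense only for homogeneous elements, whereas algebra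
  elements, vectors and homomorphisms are in general sums of an even and an odd part. Two devices
  deal with this. Identities that are additive in each argument are checked on homogeneous
  arguments, where the eight-term formula for the action in \<open>coind\<close> collapses to one
  signed term. Where one formula has to cover all \<open>x\<close>, the sign of \<open>x\<close>
  against a parity \<open>p\<close> is replaced by the \<open>p\<close>-th power
  \<open>uq_twist p\<close> of the parity automorphism. Averaging over this automorphism, possible
  because 2 is invertible in the ground field, produces homogeneous components inside every
  sub-superalgebra. A Hom space sees its target only through components, scalars and action;
  \<open>ind\<close> takes the last two from \<open>coind\<close>, so passing to the induced module
  is only a question of where the values lie.\<close>

declare add_bit_eq_xor [simp del] mult_bit_eq_and [simp del]

section \<open>Koszul signs\<close>

lemma ksign_zero [simp]: "ksign p 0 = 0"
  by (simp add: ksign_def)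

lemma ksign_0 [simp]: "ksign 0 v = v"
  by (simp add: ksign_def)

lemma ksign_add: "ksign p (u + v) = ksign p u + ksign p v"
  by (simp add: ksign_def)

lemma ksign_ksign: "ksign p (ksign r v) = ksign (p + r) v"
  by (cases p; cases r) (auto simp: ksign_def)

section \<open>The parity automorphism\<close>

text \<open>Induction over monomials: updating a coefficient at a key outside the support is the
  same as adding a monomial. Identities additive in \<open>x\<close> thus reduce to single
  words.\<close>

lemma falg_induct [case_names zero single add]:
  fixes x :: "('m::finite, 'n::finite) falg"
  assumes "P 0" "\<And>k c. P (Poly_Mapping.single k c)" "\<And>x y. P x \<Longrightarrow> P y \<Longrightarrow> P (x + y)"
  shows "P x"
proof (induction x rule: update_induct)
  case const
  show ?case by (rule assms(1))
next
  case (update f k c)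
  have "Poly_Mapping.update k c f = f + Poly_Mapping.single k c"
    using update(1)
    by (intro poly_mapping_eqI)
      (auto simp: lookup_add lookup_update lookup_single when_def not_in_keys_iff_lookup_eq_zero)
  then show ?case using assms(2,3) update by metis
qed

definition word_sign :: "('m::finite, 'n::finite) gen word \<Rightarrow> cq" where
  "word_sign w = (if word_parity w = 0 then 1 else - 1)"

text \<open>The parity automorphism, written coefficientwise so that additivity is immediate;
  multiplicativity rests on \<open>word_sign\<close> being a character of the word monoid.\<close>

lift_definition falg_sgn :: "('m::finite, 'n::finite) falg \<Rightarrow> ('m, 'n) falg"
  is "\<lambda>f w. word_sign w * f w"
  by (erule finite_subset[rotated]) auto

lemma word_parity_add: "word_parity (v + w) = word_parity v + word_parity w"
  by (simp add: word_parity_def plus_word_def)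

lemma word_sign_add: "word_sign (v + w) = word_sign v * word_sign w"
  by (cases "word_parity v"; cases "word_parity w")
    (auto simp: word_sign_def word_parity_add)

lemma lookup_falg_sgn: "Poly_Mapping.lookup (falg_sgn x) w = word_sign w * Poly_Mapping.lookup x w"
  by transfer simp

lemma falg_sgn_zero [simp]: "falg_sgn 0 = 0"
  by transfer simp

lemma falg_sgn_add [simp]: "falg_sgn (x + y) = falg_sgn x + falg_sgn y"
  by transfer (simp add: algebra_simps)

lemma falg_sgn_uminus [simp]: "falg_sgn (- x) = - falg_sgn x"
  by (rule poly_mapping_eqI) (simp add: lookup_falg_sgn)

lemma falg_sgn_diff [simp]: "falg_sgn (x - y) = falg_sgn x - falg_sgn y"
  using falg_sgn_add[of x "- y"] by simp

lemma falg_sgn_single: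
  "falg_sgn (Poly_Mapping.single w c) = Poly_Mapping.single w (word_sign w * c)"
  by transfer (auto simp: when_def)

lemma falg_sgn_mult [simp]: "falg_sgn (x * y) = falg_sgn x * falg_sgn y"
proof (induction x rule: falg_induct)
  case (single k c)
  show ?case
    by (induction y rule: falg_induct)
      (simp_all add: falg_sgn_single mult_single word_sign_add distrib_left mult.assoc mult.left_commute)
qed (simp_all add: distrib_right)

lemma word_sign_zero: "word_sign 0 = 1"
  by (simp add: word_sign_def word_parity_def zero_word_def)

lemma falg_sgn_cst [simp]: "falg_sgn (cst c) = cst c"
  by (simp add: cst_def falg_sgn_single word_sign_zero)

lemma falg_sgn_one [simp]: "falg_sgn 1 = 1"
  using falg_sgn_cst[of 1] by (simp add: cst_def)

lemma falg_sgn_letter: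
  assumes "gen_ok (CARD('m) + CARD('n)) g"
  shows "falg_sgn (letter g :: ('m::finite, 'n::finite) falg) = ksign (raw_parity CARD('m) g) (letter g)"
  using assms
  by (simp add: letter_def falg_sgn_single word_sign_def word_parity_def Abs_gen_inverse ksign_def single_uminus)


lemma falg_sgn_gen:
  fixes a :: nat
  defines "M \<equiv> CARD('m)" and "N \<equiv> CARD('m) + CARD('n)"
  shows "a \<in> {1..N - 1} \<Longrightarrow> falg_sgn (fE a :: ('m::finite, 'n::finite) falg) = (if a = M then - fE a else fE a)"
    and "a \<in> {1..N - 1} \<Longrightarrow> falg_sgn (fF a :: ('m, 'n) falg) = (if a = M then - fF a else fF a)"
    and "a \<in> {1..N} \<Longrightarrow> falg_sgn (fK a :: ('m, 'n) falg) = fK a"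
    and "a \<in> {1..N} \<Longrightarrow> falg_sgn (fKinv a :: ('m, 'n) falg) = fKinv a"
  unfolding M_def N_def by (subst falg_sgn_letter; simp add: ksign_def)+

text \<open>\<open>E_m\<close> and \<open>F_m\<close> are the only odd root generators, so a root
  vector is odd exactly when its index interval crosses from \<open>m\<close> to
  \<open>m + 1\<close>. Splitting at \<open>c\<close> leaves that crossing in exactly one of the two
  factors, whichever \<open>c\<close> is chosen. The bounds keep the generators at the leaves of the
  recursion admissible, where their parity is known.\<close>

lemma falg_sgn_root_vec:
  fixes x :: "('m::finite, 'n::finite) falg"
  assumes "root_vec a b x" "1 \<le> a" "1 \<le> b" "a \<le> CARD('m) + CARD('n)" "b \<le> CARD('m) + CARD('n)"
  shows "falg_sgn x = (if min a b \<le> CARD('m) \<and> CARD('m) < max a b then - x else x)"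
  using assms
proof (induction rule: root_vec.induct)
  case (3 a c b x y)
  then show ?case by (auto simp: min_def max_def)
next
  case (4 a c b x y)
  then show ?case by (auto simp: min_def max_def)
qed (auto simp: falg_sgn_gen min_def max_def)

text \<open>Both sides of each defining relation have one common parity; a side equal to 0 has every
  parity. This is what lets the parity automorphism descend to the quotient.\<close>

lemma uq_rel_homogeneous:
  fixes x y :: "('m::finite, 'n::finite) falg"
  assumes "uq_rel x y"
  shows "\<exists>p. falg_sgn x = ksign p x \<and> falg_sgn y = ksign p y"
proof -
  have eq: "\<exists>p. falg_sgn x = ksign p x \<and> falg_sgn y = ksign p y"
    if "falg_sgn x = x \<and> falg_sgn y = y \<or> falg_sgn x = - x \<and> falg_sgn y = - y" for x y :: "('m, 'n) falg"
    using that by (metis ksign_def bit.distinct(1))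
  \<comment> \<open>Both blocks are nonempty, so the odd node is an admissible index.\<close>
  have M: "CARD('m) \<in> {1..CARD('m) + CARD('n) - 1}"
  proof -
    have "0 < CARD('m)" "0 < CARD('n)" by simp_all
    then have "1 \<le> CARD('m) \<and> CARD('m) \<le> CARD('m) + CARD('n) - 1" by linarith
    then show ?thesis by simp
  qed
  from assms show ?thesis
  proof cases
    case (odd_E x)
    \<comment> \<open>The interval from \<open>m - 1\<close> to \<open>m + 2\<close> crosses the odd
      node, and blocks of size at least 2 keep both ends in range. The product with the odd
      generator is then even.\<close>
    then have "falg_sgn x = - x"
      by (subst falg_sgn_root_vec[OF odd_E(5)]) auto
    then show ?thesis using odd_E M by (intro eq) (simp add: falg_sgn_gen)
  next
    case (odd_F x)
    then have "falg_sgn x = - x"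
      by (subst falg_sgn_root_vec[OF odd_F(5)]) auto
    then show ?thesis using odd_F M by (intro eq) (simp add: falg_sgn_gen)
  next
    case (E_F a b)
    then show ?thesis by (intro eq) (auto simp: falg_sgn_gen)
  next
    case (K_inv b)
    then show ?thesis by (intro eq) (simp add: falg_sgn_gen)
  next
    case (K_K a b x y)
    then show ?thesis by (intro eq) (elim insertE; simp add: falg_sgn_gen)
  next
    case (K_E a b)
    then show ?thesis by (intro eq) (simp add: falg_sgn_gen)
  next
    case (K_F a b)
    then show ?thesis by (intro eq) (simp add: falg_sgn_gen)
  next
    case E_odd
    then show ?thesis using M by (intro eq) (simp add: falg_sgn_gen)
  next
    case F_odd
    then show ?thesis using M by (intro eq) (simp add: falg_sgn_gen)
  next
    case (E_E a b)
    then show ?thesis by (intro eq) (simp add: falg_sgn_gen)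
  next
    case (F_F a b)
    then show ?thesis by (intro eq) (simp add: falg_sgn_gen)
  next
    case (serre_E a b)
    then have "a \<noteq> CARD('m)" "a \<in> {1..CARD('m) + CARD('n) - 1}" "b \<in> {1..CARD('m) + CARD('n) - 1}"
      by blast+
    then show ?thesis unfolding serre_E(1,2) by (intro eq) (simp add: falg_sgn_gen serre_def)
  next
    case (serre_F a b)
    then have "a \<noteq> CARD('m)" "a \<in> {1..CARD('m) + CARD('n) - 1}" "b \<in> {1..CARD('m) + CARD('n) - 1}"
      by blast+
    then show ?thesis unfolding serre_F(1,2) by (intro eq) (simp add: falg_sgn_gen serre_def)
  qed
qed

lemma uq_cong_ksign: "uq_cong x y \<Longrightarrow> uq_cong (ksign p x) (ksign p y)"
  using uq_cong.mult[OF uq_cong.refl[of "- 1"]] by (force simp: ksign_def)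

text \<open>The generating relations are the only case with content: there both sides are multiplied
  by a common sign. The closure rules pass through a ring homomorphism.\<close>

lemma uq_cong_falg_sgn: "uq_cong x y \<Longrightarrow> uq_cong (falg_sgn x) (falg_sgn y)"
proof (induction rule: uq_cong.induct)
  case (rel x y)
  then show ?case
    using uq_rel_homogeneous[OF rel] uq_cong_ksign[OF uq_cong.rel[OF rel]] by auto
qed (auto intro: uq_cong.intros)

lift_definition uq_sgn :: "('m::finite, 'n::finite) uq \<Rightarrow> ('m, 'n) uq" is falg_sgn
  by (rule uq_cong_falg_sgn)

lemma uq_sgn_add: "uq_sgn (x + y) = uq_sgn x + uq_sgn y"
  by transfer (simp add: uq_cong.refl)

lemma uq_sgn_mult: "uq_sgn (x * y) = uq_sgn x * uq_sgn y"
  by transfer (simp add: uq_cong.refl)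

lemma uq_sgn_one: "uq_sgn 1 = 1"
  by transfer (simp add: uq_cong.refl)

lemma uq_sgn_scale: "uq_sgn (uq_scale c x) = uq_scale c (uq_sgn x)"
  by transfer (simp add: uq_cong.refl)

lemma uq_sgn_K:
  assumes "b \<in> {1..CARD('m) + CARD('n)}"
  shows "uq_sgn (uK b :: ('m::finite, 'n::finite) uq) = uK b"
    and "uq_sgn (uKinv b :: ('m, 'n) uq) = uKinv b"
  using assms by (transfer, simp add: falg_sgn_gen uq_cong.refl)+

lemma uq_sgn_EF:
  assumes "a \<in> {1..CARD('m) + CARD('n) - 1}"
  shows "uq_sgn (uE a :: ('m::finite, 'n::finite) uq) = ksign (if a = CARD('m) then 1 else 0) (uE a)"
    and "uq_sgn (uF a :: ('m, 'n) uq) = ksign (if a = CARD('m) then 1 else 0) (uF a)"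
  unfolding ksign_def using assms by (transfer, auto simp: falg_sgn_gen uq_cong.refl)+

section \<open>Scalars on the quotient algebra\<close>

lemma cst_add: "cst (a + b) = cst a + cst b"
  by (simp add: cst_def single_add)

lemma cst_mult: "cst (a * b) = cst a * cst b"
  by (simp add: cst_def mult_single)

lemma cst_one: "cst 1 = 1"
  by (simp add: cst_def)

lemma cst_central: "cst c * x = x * (cst c :: ('m::finite, 'n::finite) falg)"
  by (induction x rule: falg_induct) (simp_all add: distrib_left distrib_right cst_def mult_single mult.commute)

interpretation uq: vector_space "uq_scale :: cq \<Rightarrow> ('m::finite, 'n::finite) uq \<Rightarrow> ('m, 'n) uq"
proof
  fix a b :: cq and x y :: "('m, 'n) uq"
  show "uq_scale a (x + y) = uq_scale a x + uq_scale a y"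
    by transfer (simp add: distrib_left uq_cong.refl)
  show "uq_scale (a + b) x = uq_scale a x + uq_scale b x"
    by transfer (simp add: cst_add distrib_right uq_cong.refl)
  show "uq_scale a (uq_scale b x) = uq_scale (a * b) x"
    by transfer (simp add: cst_mult mult.assoc uq_cong.refl)
  show "uq_scale 1 x = x"
    by transfer (simp add: cst_one uq_cong.refl)
qed

lemma uq_scale_mult_left: "uq_scale c x * y = uq_scale c (x * y)"
  by transfer (simp add: mult.assoc uq_cong.refl)

lemma uq_scale_mult_right: "x * uq_scale c y = uq_scale c (x * y)"
proof (transfer fixing: c)
  fix x y :: "('a, 'b) falg"
  have "x * (cst c * y) = cst c * (x * y)"
    by (simp add: cst_central[of c x] flip: mult.assoc)
  then show "uq_cong (x * (cst c * y)) (cst c * (x * y))"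
    by (simp add: uq_cong.refl)
qed

section \<open>Homogeneous components as eigenspaces of the parity automorphism\<close>

lemma falg_sgn_eq_ksign:
  assumes "\<forall>w \<in> Poly_Mapping.keys x. word_parity w = p"
  shows "falg_sgn x = ksign p x"
proof (rule poly_mapping_eqI)
  fix w
  show "Poly_Mapping.lookup (falg_sgn x) w = Poly_Mapping.lookup (ksign p x) w"
    using assms
    by (cases "w \<in> Poly_Mapping.keys x")
      (auto simp: lookup_falg_sgn word_sign_def ksign_def not_in_keys_iff_lookup_eq_zero)
qed

text \<open>Adding the signed image cancels all coefficients at words of the other parity: up to the
  factor 2 this is the projection to parity \<open>p\<close>.\<close>

lemma keys_falg_sgn_avg:
  "\<forall>w \<in> Poly_Mapping.keys (x + ksign p (falg_sgn x)). word_parity w = p"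
  by (auto simp: in_keys_iff lookup_add lookup_minus ksign_def lookup_falg_sgn word_sign_def split: if_splits)

text \<open>Needed for averaging, and for the independence of the eigenspaces for 1 and -1.\<close>

lemma cq_two_nonzero: "(2 :: cq) \<noteq> 0"
proof -
  have "(2 :: cq) = 1 + 1"
    by simp
  also have "\<dots> = Fraction_Field.Fract 2 1"
    unfolding One_fract_def by simp
  finally have two: "(2 :: cq) = Fraction_Field.Fract 2 1" .
  show ?thesis
    unfolding two Zero_fract_def by (subst eq_fract) auto
qed

text \<open>\<open>uq_gr\<close> asks for some homogeneous representative, which is awkward to
  exhibit; the eigenvalue condition can be tested on the class itself.\<close>

lemma uq_gr_iff: "x \<in> uq_gr p \<longleftrightarrow> uq_sgn x = ksign p x"
proof
  assume "x \<in> uq_gr p"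
  then obtain y where y: "x = abs_uq y" "\<forall>w \<in> Poly_Mapping.keys y. word_parity w = p"
    by (auto simp: uq_gr_def)
  have "abs_uq (ksign p y) = ksign p (abs_uq y)"
    by (simp add: ksign_def uminus_uq.abs_eq)
  then show "uq_sgn x = ksign p x"
    using falg_sgn_eq_ksign[OF y(2)] by (simp add: y(1) uq_sgn.abs_eq)
next
  assume sgn: "uq_sgn x = ksign p x"
  obtain y where y: "x = abs_uq y"
    by (metis Quotient3_abs_rep Quotient3_uq)
  \<comment> \<open>An arbitrary representative of an eigenvector may mix parities. \<open>z\<close>
    is homogeneous and represents \<open>2 x\<close>, so half of it is the representative
    wanted.\<close>
  define z where "z = y + ksign p (falg_sgn y)"
  have "abs_uq z = x + ksign p (uq_sgn x)"
    by (simp add: z_def y plus_uq.abs_eq[symmetric] ksign_def uminus_uq.abs_eq uq_sgn.abs_eq)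
  also have "\<dots> = uq_scale 2 x"
    using uq.scale_left_distrib[of 1 1 x] by (simp add: sgn ksign_def)
  finally have "abs_uq (cst (1 / 2) * z) = x"
    by (simp add: uq_scale.abs_eq[symmetric] cq_two_nonzero)
  moreover have "\<forall>w \<in> Poly_Mapping.keys (cst (1 / 2) * z). word_parity w = p"
    using keys_mult[of "cst (1 / 2)" z] keys_falg_sgn_avg[of y p]
    by (fastforce simp: z_def cst_def split: if_splits)
  ultimately show "x \<in> uq_gr p"
    unfolding uq_gr_def by blast
qed

section \<open>Graded spaces\<close>

lemma gtotal_cases:
  assumes "v \<in> gtotal G"
  obtains u w where "u \<in> G 0" "w \<in> G 1" "v = u + w"
  using assms by (auto simp: gtotal_def)

lemma gtotal_mono: "(\<And>p. G p \<subseteq> H p) \<Longrightarrow> gtotal G \<subseteq> gtotal H"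
  unfolding gtotal_def by blast

text \<open>Only the additive structure is recorded, so that the same facts serve the algebra, its
  sub-superalgebras, modules, Hom spaces and submodules.\<close>

locale graded_space =
  fixes G :: "bit \<Rightarrow> 'v::ab_group_add set"
  assumes zero_mem: "0 \<in> G p"
    and add_mem: "u \<in> G p \<Longrightarrow> v \<in> G p \<Longrightarrow> u + v \<in> G p"
    and uminus_mem: "u \<in> G p \<Longrightarrow> - u \<in> G p"
    and independent: "u \<in> G 0 \<Longrightarrow> u \<in> G 1 \<Longrightarrow> u = 0"
begin

lemma diff_mem: "u \<in> G p \<Longrightarrow> v \<in> G p \<Longrightarrow> u - v \<in> G p"
  using add_mem[of u p "- v"] uminus_mem by simp

lemma ksign_mem: "u \<in> G p \<Longrightarrow> ksign r u \<in> G p"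
  by (simp add: ksign_def uminus_mem)

lemma independent': "u \<in> G p \<Longrightarrow> u \<in> G (p + 1) \<Longrightarrow> u = 0"
  by (cases p) (auto intro: independent)

lemma gtotal_add: "u \<in> gtotal G \<Longrightarrow> v \<in> gtotal G \<Longrightarrow> u + v \<in> gtotal G"
proof (elim gtotal_cases)
  fix a b c d
  assume "a \<in> G 0" "b \<in> G 1" "u = a + b" "c \<in> G 0" "d \<in> G 1" "v = c + d"
  moreover from this have "a + c \<in> G 0" "b + d \<in> G 1" "u + v = (a + c) + (b + d)"
    by (simp_all add: add_mem)
  ultimately show "u + v \<in> gtotal G"
    unfolding gtotal_def by blast
qed

lemma gtotal_mem: "u \<in> G p \<Longrightarrow> u \<in> gtotal G"
  by (cases p) (use zero_mem in \<open>force simp: gtotal_def\<close>)+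

lemma gtotal_zero: "0 \<in> gtotal G"
  using gtotal_mem zero_mem by blast

lemma gtotal_uminus: "u \<in> gtotal G \<Longrightarrow> - u \<in> gtotal G"
  by (elim gtotal_cases) (metis minus_add_distrib gtotal_add gtotal_mem uminus_mem)

lemma gtotal_ksign: "u \<in> gtotal G \<Longrightarrow> ksign r u \<in> gtotal G"
  by (simp add: ksign_def gtotal_uminus)

lemma gtotal_induct [consumes 1, case_names homogeneous add]:
  assumes "v \<in> gtotal G" "\<And>p u. u \<in> G p \<Longrightarrow> P u"
    "\<And>u w. u \<in> gtotal G \<Longrightarrow> w \<in> gtotal G \<Longrightarrow> P u \<Longrightarrow> P w \<Longrightarrow> P (u + w)"
  shows "P v"
  using assms by (metis gtotal_cases gtotal_mem)

text \<open>The difference of two candidates lies in both components, hence is 0, so the description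
  in \<open>gproj\<close> is unique.\<close>

lemma gproj_eqI:
  assumes "u \<in> G p" "v - u \<in> G (p + 1)"
  shows "gproj G p v = u"
  unfolding gproj_def
proof (rule the_equality)
  fix w assume w: "w \<in> G p \<and> v - w \<in> G (p + 1)"
  have "w - u \<in> G p" using w assms diff_mem by blast
  moreover have "(v - u) - (v - w) \<in> G (p + 1)" using w assms diff_mem by blast
  then have "w - u \<in> G (p + 1)" by simp
  ultimately show "w = u" using independent' by force
qed (use assms in auto)

lemma gproj_homogeneous: "v \<in> G p \<Longrightarrow> gproj G r v = (if r = p then v else 0)"
  by (cases p; cases r) (auto intro!: gproj_eqI simp: zero_mem)

lemma gproj_split:
  assumes "v \<in> gtotal G"
  shows "gproj G p v \<in> G p" "gproj G 0 v + gproj G 1 v = v"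
proof -
  obtain u w where "u \<in> G 0" "w \<in> G 1" and v: "v = u + w"
    using assms by (rule gtotal_cases)
  moreover from this have "gproj G 0 v = u" "gproj G 1 v = w"
    by (auto intro!: gproj_eqI)
  ultimately show "gproj G p v \<in> G p" "gproj G 0 v + gproj G 1 v = v"
    by (cases p; simp)+
qed

lemma gproj_diff: "v \<in> gtotal G \<Longrightarrow> v - gproj G p v \<in> G (p + 1)"
  using gproj_split(1)[of v "p + 1"] gproj_split(2)[of v]
  by (cases p) (metis add_0 add_diff_cancel_left', metis add_diff_cancel_right' bit_2_eq_0 one_add_one)

lemma gproj_add:
  assumes "u \<in> gtotal G" "v \<in> gtotal G"
  shows "gproj G p (u + v) = gproj G p u + gproj G p v"
proof (rule gproj_eqI)
  show "gproj G p u + gproj G p v \<in> G p"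
    using assms by (simp add: add_mem gproj_split)
  have "(u - gproj G p u) + (v - gproj G p v) \<in> G (p + 1)"
    using assms by (simp add: add_mem gproj_diff)
  then show "u + v - (gproj G p u + gproj G p v) \<in> G (p + 1)"
    by (simp add: algebra_simps)
qed

end

section \<open>Sub-superalgebras\<close>

lemma uq_gr_one: "1 \<in> uq_gr 0"
  by (simp add: uq_gr_iff uq_sgn_one)

lemma uq_gr_mult: "x \<in> uq_gr i \<Longrightarrow> y \<in> uq_gr j \<Longrightarrow> x * y \<in> uq_gr (i + j)"
  by (cases i; cases j) (auto simp: uq_gr_iff uq_sgn_mult ksign_def)

lemma uq_gr_scale: "x \<in> uq_gr i \<Longrightarrow> uq_scale c x \<in> uq_gr i"
  by (simp add: uq_gr_iff uq_sgn_scale ksign_def)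

lemma uq_sgn_uq_sgn [simp]: "uq_sgn (uq_sgn x) = (x :: ('m::finite, 'n::finite) uq)"
proof -
  have "falg_sgn (falg_sgn x) = x" for x :: "('m, 'n) falg"
    by (rule poly_mapping_eqI) (simp add: lookup_falg_sgn word_sign_def)
  then show ?thesis by transfer (simp add: uq_cong.refl)
qed

lemma uq_sgn_uminus: "uq_sgn (- x) = - uq_sgn x"
  using uq_sgn_scale[of "- 1" x] by simp

lemma uq_avg: "uq_scale (1 / 2) (x + x) = x"
proof -
  have "x + x = uq_scale 2 x"
    using uq.scale_left_distrib[of 1 1 x] by simp
  then show ?thesis by (simp add: cq_two_nonzero)
qed

interpretation uq_gr: graded_space uq_gr
proof
  fix u :: "('a, 'b) uq"
  assume "u \<in> uq_gr 0" "u \<in> uq_gr 1"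
  then have "u = - u" by (simp add: uq_gr_iff ksign_def)
  then have "u + u = 0" by (metis add.right_inverse)
  then show "u = 0" by (metis uq_avg uq.scale_zero_right)
qed (auto simp: uq_gr_iff uq_sgn_add uq_sgn_uminus ksign_def uq_sgn_scale[of 0, simplified])

text \<open>Gradedness is encoded as stability under the parity automorphism: this can be checked on
  generators, and the splitting into components then follows by averaging.\<close>

locale sub_superalgebra =
  fixes A :: "('m::finite, 'n::finite) uq set"
  assumes one_mem: "1 \<in> A"
    and scale_mem: "x \<in> A \<Longrightarrow> uq_scale c x \<in> A"
    and plus_mem: "x \<in> A \<Longrightarrow> y \<in> A \<Longrightarrow> x + y \<in> A"
    and times_mem: "x \<in> A \<Longrightarrow> y \<in> A \<Longrightarrow> x * y \<in> A"
    and sgn_mem: "x \<in> A \<Longrightarrow> uq_sgn x \<in> A"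
begin

lemma minus_mem: "x \<in> A \<Longrightarrow> - x \<in> A"
  using scale_mem[of x "- 1"] by simp

lemma null_mem: "0 \<in> A"
  using scale_mem[OF one_mem, of 0] by simp

sublocale gr: graded_space "\<lambda>p. A \<inter> uq_gr p"
  using null_mem plus_mem minus_mem uq_gr.zero_mem uq_gr.add_mem uq_gr.uminus_mem uq_gr.independent
  by unfold_locales auto

lemma gtotal_eq [simp]: "gtotal (\<lambda>p. A \<inter> uq_gr p) = A"
proof
  show "gtotal (\<lambda>p. A \<inter> uq_gr p) \<subseteq> A"
    by (auto elim!: gtotal_cases intro: plus_mem)
  show "A \<subseteq> gtotal (\<lambda>p. A \<inter> uq_gr p)"
  proof
    fix x assume x: "x \<in> A"
    \<comment> \<open>The two eigencomponents of \<open>x\<close>; they add up to \<open>x\<close>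
      because the signed images cancel.\<close>
    let ?u = "\<lambda>p. uq_scale (1 / 2) (x + ksign p (uq_sgn x))"
    have "?u p \<in> A" for p
      using x by (auto simp: ksign_def intro!: scale_mem plus_mem sgn_mem minus_mem simp flip: add_uminus_conv_diff)
    moreover have "?u p \<in> uq_gr p" for p
      unfolding uq_gr_iff
      by (simp add: uq_sgn_scale uq_sgn_add uq_sgn_uminus ksign_def uq.scale_right_diff_distrib uq.scale_right_distrib add.commute)
    ultimately have "?u p \<in> A \<inter> uq_gr p" for p
      by blast
    then have "?u 0 + ?u 1 \<in> gtotal (\<lambda>p. A \<inter> uq_gr p)"
      by (blast intro: gr.gtotal_add gr.gtotal_mem)
    moreover have "?u 0 + ?u 1 = x"
      using uq_avg[of x] by (simp add: ksign_def flip: uq.scale_right_distrib)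
    ultimately show "x \<in> gtotal (\<lambda>p. A \<inter> uq_gr p)"
      by (simp only:)
  qed
qed

lemma gtotal_uq_gr: "x \<in> A \<Longrightarrow> x \<in> gtotal uq_gr"
  using gtotal_mono[of "\<lambda>p. A \<inter> uq_gr p" uq_gr] by auto

text \<open>The action in \<open>coind\<close> projects in the whole algebra. By uniqueness these
  projections agree with the ones taken inside \<open>A\<close>, so they do not leave
  \<open>A\<close>.\<close>

lemma gproj_uq_gr:
  assumes "x \<in> A"
  shows "gproj uq_gr p x \<in> A \<inter> uq_gr p"
proof -
  have "gproj uq_gr p x = gproj (\<lambda>p. A \<inter> uq_gr p) p x"
    using gr.gproj_split(1)[of x p] gr.gproj_diff[of x p] assms
    by (intro uq_gr.gproj_eqI) auto
  then show ?thesis using gr.gproj_split(1)[of x p] assms by simp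
qed

lemma homogeneous_induct [consumes 1, case_names homogeneous add]:
  assumes "x \<in> A" "\<And>p u. u \<in> A \<Longrightarrow> u \<in> uq_gr p \<Longrightarrow> P u"
    "\<And>u w. u \<in> A \<Longrightarrow> w \<in> A \<Longrightarrow> P u \<Longrightarrow> P w \<Longrightarrow> P (u + w)"
  shows "P x"
  using gr.gtotal_induct[of x P] assms by auto

end

text \<open>Each admissible generator is an eigenvector of the parity automorphism with eigenvalue 1
  or -1, and the closure rules respect a scalar-linear ring homomorphism.\<close>

lemma sub_superalgebra_uq_sub:
  assumes "Tp \<subseteq> {1..CARD('m) + CARD('n) - 1}" "Tm \<subseteq> {1..CARD('m) + CARD('n) - 1}"
  shows "sub_superalgebra (uq_sub Tp Tm :: ('m::finite, 'n::finite) uq set)"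
proof
  have minus: "- x \<in> uq_sub Tp Tm" if "x \<in> uq_sub Tp Tm" for x :: "('m, 'n) uq"
    using uq_sub.intros(6)[OF that, of "- 1"] by simp
  fix x :: "('m, 'n) uq"
  assume "x \<in> uq_sub Tp Tm"
  then show "uq_sgn x \<in> uq_sub Tp Tm"
  proof induction
    case (3 a)
    then have "a \<in> {1..CARD('m) + CARD('n) - 1}" using assms by blast
    then show ?case using 3 by (simp only: uq_sgn_EF) (auto simp: ksign_def intro: uq_sub.intros minus)
  next
    case (4 a)
    then have "a \<in> {1..CARD('m) + CARD('n) - 1}" using assms by blast
    then show ?case using 4 by (simp only: uq_sgn_EF) (auto simp: ksign_def intro: uq_sub.intros minus)
  qed (auto simp: uq_sgn_K uq_sgn_one uq_sgn_scale uq_sgn_add uq_sgn_mult intro: uq_sub.intros)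
qed (auto intro: uq_sub.intros)

lemma quantum_pair_cases:
  fixes Q K :: "('m::finite, 'n::finite) uq set"
  assumes "quantum_pair Q K"
  obtains Tp Tm T where "Q = uq_sub Tp Tm" "K = uq_sub T T"
    "Tp \<subseteq> {1..CARD('m) + CARD('n) - 1}" "Tm \<subseteq> {1..CARD('m) + CARD('n) - 1}"
    "T \<subseteq> {1..CARD('m) + CARD('n) - 1}"
  using assms unfolding quantum_pair_def parabolic_def reductive_def Let_def by blast

lemma quantum_pair_sub_superalgebra:
  fixes Q K :: "('m::finite, 'n::finite) uq set"
  assumes "quantum_pair Q K"
  shows "sub_superalgebra Q" "sub_superalgebra K"
  using quantum_pair_cases[OF assms] sub_superalgebra_uq_sub by metis+

lemma uK_mem_quantum_pair:
  fixes Q K :: "('m::finite, 'n::finite) uq set"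
  assumes "quantum_pair Q K" "b \<in> {1..CARD('m) + CARD('n)}"
  shows "uK b \<in> Q"
  using quantum_pair_cases[OF assms(1)] assms(2) by (metis uq_sub.intros(1))

section \<open>Supermodules and their homomorphisms\<close>

context supermodule
begin

sublocale gr: graded_space "gr V"
  using gr_subspace gr_independent by unfold_locales (auto intro: subspace_0 subspace_add subspace_neg)

lemma carr_scale: "v \<in> carr V \<Longrightarrow> smul V c v \<in> carr V"
  by (elim gtotal_cases)
    (metis gr.gtotal_add gr.gtotal_mem gr_subspace scale_right_distrib subspace_scale)

lemma subspace_carr: "subspace (carr V)"
  by (intro subspaceI gr.gtotal_zero gr.gtotal_add carr_scale)

lemma smul_ksign: "smul V c (ksign p v) = ksign p (smul V c v)"
  by (simp add: ksign_def)

lemma act_ksign_right: "x \<in> A \<Longrightarrow> v \<in> carr V \<Longrightarrow> act V x (ksign p v) = ksign p (act V x v)"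
  using act_smul_right[of x v "- 1"] by (simp add: ksign_def)

lemma act_zero_right: "x \<in> A \<Longrightarrow> act V x 0 = 0"
  using act_smul_right[of x 0 0] gr.gtotal_zero by simp

lemma act_homogeneous: "x \<in> A \<Longrightarrow> x \<in> uq_gr i \<Longrightarrow> v \<in> gr V j \<Longrightarrow> act V x v \<in> gr V (i + j)"
  using act_gr by blast

text \<open>The axiom \<open>act_gr\<close> speaks of homogeneous elements and vectors only.
  Decomposing both arguments gives the general case; the components of \<open>x\<close> must
  themselves lie in \<open>A\<close>.\<close>

lemma act_carr:
  assumes "sub_superalgebra A" "x \<in> A" "v \<in> carr V"
  shows "act V x v \<in> carr V"
proof -
  interpret A: sub_superalgebra A by fact
  show ?thesis
    using assms(2)
  proof (induction x rule: A.homogeneous_induct)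
    case x: (homogeneous p x)
    show ?case
      using assms(3)
      by (induction v rule: gr.gtotal_induct)
        (use x in \<open>auto simp: act_add_right intro: gr.gtotal_add gr.gtotal_mem[OF act_homogeneous]\<close>)
  qed (use assms in \<open>simp add: act_add_left gr.gtotal_add\<close>)
qed

lemma act_ksign_left:
  assumes "x \<in> A" "v \<in> carr V"
  shows "act V (ksign p x) v = ksign p (act V x v)"
  using act_scale_left[OF assms, of "- 1"] by (simp add: ksign_def)

end

lemma supermodule_regular_mod:
  assumes "sub_superalgebra Q" "P \<subseteq> Q"
  shows "supermodule P (regular_mod Q)"
proof -
  interpret Q: sub_superalgebra Q by fact
  interpret vector_space "smul (regular_mod Q)"
    using uq.vector_space_axioms by (simp add: regular_mod_def)
  show ?thesis
  proof
    show "subspace (gr (regular_mod Q) p)" for p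
      by (auto simp: uq.subspace_def regular_mod_def Q.null_mem Q.plus_mem Q.scale_mem uq_gr.zero_mem
          uq_gr.add_mem uq_gr_scale)
    show "gr (regular_mod Q) 0 \<inter> gr (regular_mod Q) 1 = {0}"
      using uq_gr.independent by (auto simp: regular_mod_def Q.null_mem uq_gr.zero_mem)
  qed (use assms(2) in \<open>auto simp: regular_mod_def algebra_simps uq_scale_mult_left uq_scale_mult_right
      intro: Q.times_mem uq_gr_mult\<close>)
qed

lemma supermodule_forget:
  assumes "supermodule Q W" "sub_superalgebra P" "P \<subseteq> Q"
  shows "supermodule P (forget P W)"
proof -
  interpret supermodule Q W by fact
  interpret P: sub_superalgebra P by fact
  have "vector_space (smul (forget P W))"
    by (simp add: forget_def vector_space_axioms)
  then interpret F: vector_space "smul (forget P W)" .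
  have sub: "F.subspace (gr (forget P W) p)" for p
    using gr_subspace[of p] unfolding F.subspace_def subspace_def by (simp add: forget_def)
  show ?thesis
    by unfold_locales
      (use assms(3) sub gr_independent in \<open>auto simp: forget_def act_homogeneous act_add_right act_smul_right
        act_add_left act_scale_left act_mult act_one P.plus_mem P.scale_mem P.times_mem P.one_mem subset_iff\<close>)
qed

lemma gr_forget [simp]: "gr (forget P W) = gr W"
  and smul_forget [simp]: "smul (forget P W) = smul W"
  and act_forget: "x \<in> P \<Longrightarrow> act (forget P W) x w = act W x w"
  by (simp_all add: forget_def)

lemma vector_space_hom_smul:
  assumes "vector_space (smul W)"
  shows "vector_space (hom_smul W)"
proof -
  interpret vector_space "smul W" by fact
  show ?thesis
    by standard (auto simp: hom_smul_def fun_eq_iff scale_right_distrib scale_left_distrib)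
qed

locale supermodule_pair =
  sub_superalgebra A + V: supermodule A V + W: supermodule A W
  for A :: "('m::finite, 'n::finite) uq set"
    and V :: "('m, 'n, 'v::ab_group_add) supermod"
    and W :: "('m, 'n, 'w::ab_group_add) supermod"
begin

lemma hom_add: "\<phi> \<in> hom_gr A V W p \<Longrightarrow> u \<in> carr V \<Longrightarrow> v \<in> carr V \<Longrightarrow> \<phi> (u + v) = \<phi> u + \<phi> v"
  and hom_smul: "\<phi> \<in> hom_gr A V W p \<Longrightarrow> v \<in> carr V \<Longrightarrow> \<phi> (smul V c v) = smul W c (\<phi> v)"
  and hom_homogeneous: "\<phi> \<in> hom_gr A V W p \<Longrightarrow> v \<in> gr V j \<Longrightarrow> \<phi> v \<in> gr W (p + j)"
  and hom_act: "\<phi> \<in> hom_gr A V W p \<Longrightarrow> x \<in> A \<Longrightarrow> x \<in> uq_gr i \<Longrightarrow> v \<in> carr V \<Longrightarrow>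
    \<phi> (act V x v) = ksign (i * p) (act W x (\<phi> v))"
  and hom_outside: "\<phi> \<in> hom_gr A V W p \<Longrightarrow> v \<notin> carr V \<Longrightarrow> \<phi> v = 0"
  unfolding hom_gr_def by blast+

lemma hom_carr: "\<phi> \<in> hom_gr A V W p \<Longrightarrow> \<phi> v \<in> carr W"
proof (cases "v \<in> carr V")
  case True
  assume \<phi>: "\<phi> \<in> hom_gr A V W p"
  show ?thesis
    using True by (induction v rule: V.gr.gtotal_induct)
      (auto simp: hom_add[OF \<phi>] W.gr.gtotal_add intro: W.gr.gtotal_mem hom_homogeneous[OF \<phi>])
qed (simp add: hom_outside W.gr.gtotal_zero)

lemma hom_zero: "\<phi> \<in> hom_gr A V W p \<Longrightarrow> \<phi> 0 = 0"
  using hom_smul[of \<phi> p 0 0] V.gr.gtotal_zero by simp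

lemma hom_uminus: "\<phi> \<in> hom_gr A V W p \<Longrightarrow> v \<in> carr V \<Longrightarrow> \<phi> (- v) = - \<phi> v"
  using hom_smul[of \<phi> p v "- 1"] by simp

text \<open>Since \<open>\<phi>\<close> is additive, the other conditions need only be checked on homogeneous vectors.\<close>

lemma hom_grI:
  assumes add: "\<And>u v. u \<in> carr V \<Longrightarrow> v \<in> carr V \<Longrightarrow> \<phi> (u + v) = \<phi> u + \<phi> v"
    and smul: "\<And>c v j. v \<in> gr V j \<Longrightarrow> \<phi> (smul V c v) = smul W c (\<phi> v)"
    and gr: "\<And>v j. v \<in> gr V j \<Longrightarrow> \<phi> v \<in> gr W (p + j)"
    and act: "\<And>x i v j. x \<in> A \<Longrightarrow> x \<in> uq_gr i \<Longrightarrow> v \<in> gr V j \<Longrightarrow>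
      \<phi> (act V x v) = ksign (i * p) (act W x (\<phi> v))"
    and outside: "\<And>v. v \<notin> carr V \<Longrightarrow> \<phi> v = 0"
  shows "\<phi> \<in> hom_gr A V W p"
proof -
  have carr: "\<phi> v \<in> carr W" if "v \<in> carr V" for v
    using that by (induction v rule: V.gr.gtotal_induct)
      (auto simp: add W.gr.gtotal_add intro: W.gr.gtotal_mem gr)
  have "\<phi> (smul V c v) = smul W c (\<phi> v)" if "v \<in> carr V" for c v
    using that by (induction v rule: V.gr.gtotal_induct)
      (simp_all add: smul add V.scale_right_distrib W.scale_right_distrib V.carr_scale)
  moreover have "\<phi> (act V x v) = ksign (i * p) (act W x (\<phi> v))"
    if x: "x \<in> A" "x \<in> uq_gr i" and "v \<in> carr V" for x i v
    using that(3) by (induction v rule: V.gr.gtotal_induct)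
      (simp_all add: act add x V.act_add_right W.act_add_right V.act_carr sub_superalgebra_axioms
        carr ksign_add)
  ultimately show ?thesis
    using add gr outside by (auto simp: hom_gr_def)
qed

sublocale hom: vector_space "hom_smul W :: cq \<Rightarrow> ('v \<Rightarrow> 'w) \<Rightarrow> 'v \<Rightarrow> 'w"
  by (intro vector_space_hom_smul W.vector_space_axioms)

lemma hom_gr_subspace: "hom.subspace (hom_gr A V W p)"
proof (rule hom.subspaceI)
  show "0 \<in> hom_gr A V W p"
    by (rule hom_grI) (auto simp: W.gr.zero_mem W.act_zero_right)
next
  fix \<phi> \<psi> assume \<phi>\<psi>: "\<phi> \<in> hom_gr A V W p" "\<psi> \<in> hom_gr A V W p"
  show "\<phi> + \<psi> \<in> hom_gr A V W p"
  proof (rule hom_grI)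
    show "(\<phi> + \<psi>) (act V x v) = ksign (i * p) (act W x ((\<phi> + \<psi>) v))"
      if "x \<in> A" "x \<in> uq_gr i" "v \<in> gr V j" for x i v j
      using that \<phi>\<psi>
      by (simp add: hom_act V.gr.gtotal_mem W.act_add_right hom_carr ksign_add)
  qed (use \<phi>\<psi> in \<open>auto simp: hom_add hom_smul V.gr.gtotal_mem W.scale_right_distrib
      hom_outside intro: W.gr.add_mem hom_homogeneous\<close>)
next
  fix c \<phi> assume \<phi>: "\<phi> \<in> hom_gr A V W p"
  show "hom_smul W c \<phi> \<in> hom_gr A V W p"
  proof (rule hom_grI)
    show "hom_smul W c \<phi> (act V x v) = ksign (i * p) (act W x (hom_smul W c \<phi> v))"
      if "x \<in> A" "x \<in> uq_gr i" "v \<in> gr V j" for x i v j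
      using that \<phi>
      by (simp add: hom_act V.gr.gtotal_mem W.act_smul_right hom_carr W.smul_ksign hom_smul_def)
  qed (use \<phi> in \<open>auto simp: hom_smul_def hom_add hom_smul V.gr.gtotal_mem W.scale_right_distrib
      hom_outside mult.commute intro: W.subspace_scale[OF W.gr_subspace] hom_homogeneous\<close>)
qed

text \<open>For independence: a map that is both even and odd sends each homogeneous vector into
  both components of \<open>W\<close>, hence to 0.\<close>

sublocale hom: graded_space "hom_gr A V W"
proof
  fix \<phi> assume \<phi>: "\<phi> \<in> hom_gr A V W 0" "\<phi> \<in> hom_gr A V W 1"
  show "\<phi> = 0"
  proof
    fix v
    show "\<phi> v = 0 v"
    proof (cases "v \<in> carr V")
      case True
      then show ?thesis
      proof (induction v rule: V.gr.gtotal_induct)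
        case (homogeneous p u)
        then show ?case
          using hom_homogeneous[OF \<phi>(1), of u p] hom_homogeneous[OF \<phi>(2), of u p]
          by (auto intro: W.gr.independent'[of _ p] simp: add.commute)
      qed (simp add: hom_add[OF \<phi>(1)])
    qed (simp add: hom_outside[OF \<phi>(1)])
  qed
qed (use hom_gr_subspace in \<open>auto intro: hom.subspace_0 hom.subspace_add hom.subspace_neg\<close>)

lemma gtotal_hom_carr: "\<phi> \<in> gtotal (hom_gr A V W) \<Longrightarrow> \<phi> v \<in> carr W"
  by (erule gtotal_cases) (auto simp: hom_carr W.gr.gtotal_add)

lemma gtotal_hom_add:
  "\<phi> \<in> gtotal (hom_gr A V W) \<Longrightarrow> u \<in> carr V \<Longrightarrow> v \<in> carr V \<Longrightarrow> \<phi> (u + v) = \<phi> u + \<phi> v"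
  by (erule gtotal_cases) (auto simp: hom_add)

lemma gtotal_hom_smul:
  "\<phi> \<in> gtotal (hom_gr A V W) \<Longrightarrow> v \<in> carr V \<Longrightarrow> \<phi> (smul V c v) = smul W c (\<phi> v)"
  by (erule gtotal_cases) (auto simp: hom_smul W.scale_right_distrib)

lemma gtotal_hom_zero: "\<phi> \<in> gtotal (hom_gr A V W) \<Longrightarrow> \<phi> 0 = 0"
  by (erule gtotal_cases) (auto simp: hom_zero)

lemma gtotal_hom_outside: "\<phi> \<in> gtotal (hom_gr A V W) \<Longrightarrow> v \<notin> carr V \<Longrightarrow> \<phi> v = 0"
  by (erule gtotal_cases) (auto simp: hom_outside)

end

lemma supermodule_pairI:
  "sub_superalgebra A \<Longrightarrow> supermodule A V \<Longrightarrow> supermodule A W \<Longrightarrow> supermodule_pair A V W"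
  by (simp add: supermodule_pair_def)

section \<open>Homomorphic images of objects of the category\<close>

text \<open>The \<open>p\<close>-th power of the parity automorphism. On an element of parity
  \<open>i\<close> it is the sign with exponent \<open>i * p\<close> by which a map of parity
  \<open>p\<close> fails to commute with the action, but it makes sense for every element.\<close>

definition uq_twist :: "bit \<Rightarrow> ('m::finite, 'n::finite) uq \<Rightarrow> ('m, 'n) uq" where
  "uq_twist p x = (if p = 0 then x else uq_sgn x)"

lemma uq_twist_uq_twist [simp]: "uq_twist p (uq_twist p x) = x"
  by (simp add: uq_twist_def)

lemma uq_twist_add: "uq_twist p (x + y) = uq_twist p x + uq_twist p y"
  by (simp add: uq_twist_def uq_sgn_add)

lemma uq_twist_homogeneous: "x \<in> uq_gr i \<Longrightarrow> uq_twist p x = ksign (i * p) x"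
  by (cases p) (auto simp: uq_twist_def uq_gr_iff)

lemma uq_twist_mem: "sub_superalgebra A \<Longrightarrow> x \<in> A \<Longrightarrow> uq_twist p x \<in> A"
  by (simp add: uq_twist_def sub_superalgebra.sgn_mem)

context supermodule_pair
begin

lemma hom_act_twist:
  assumes \<phi>: "\<phi> \<in> hom_gr A V W p" and "x \<in> A" and v: "v \<in> carr V"
  shows "\<phi> (act V x v) = act W (uq_twist p x) (\<phi> v)"
  using assms(2)
proof (induction x rule: homogeneous_induct)
  case (homogeneous i x)
  then show ?case
    using v \<phi> by (simp add: uq_twist_homogeneous hom_act W.act_ksign_left hom_carr)
next
  case (add x y)
  then show ?case
    using v \<phi>
    by (simp add: V.act_add_left hom_add V.act_carr sub_superalgebra_axioms)
      (simp add: uq_twist_add W.act_add_left hom_carr uq_twist_mem sub_superalgebra_axioms)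
qed

lemma hom_image_span:
  assumes \<phi>: "\<phi> \<in> hom_gr A V W p" and X: "X \<subseteq> carr V"
  shows "\<phi> ` V.span X = W.span (\<phi> ` X)"
proof
  have sub: "V.span X \<subseteq> carr V"
    using X V.subspace_carr by (rule V.span_minimal)
  show "\<phi> ` V.span X \<subseteq> W.span (\<phi> ` X)"
  proof (rule image_subsetI)
    fix v assume "v \<in> V.span X"
    \<comment> \<open>Membership in the carrier is carried along because linearity of
      \<open>\<phi>\<close> is known only there.\<close>
    then have "v \<in> carr V \<and> \<phi> v \<in> W.span (\<phi> ` X)"
    proof (induction v rule: V.span_induct_alt)
      case base
      then show ?case using \<phi> by (simp add: hom_zero V.gr.gtotal_zero W.span_zero)
    next
      case (step c x y)
      then have "x \<in> carr V" "\<phi> x \<in> W.span (\<phi> ` X)"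
        using X by (blast intro: W.span_base)+
      with step show ?case
        by (simp add: hom_add[OF \<phi>] hom_smul[OF \<phi>] V.carr_scale V.gr.gtotal_add W.span_add W.span_scale)
    qed
    then show "\<phi> v \<in> W.span (\<phi> ` X)" ..
  qed
  show "W.span (\<phi> ` X) \<subseteq> \<phi> ` V.span X"
  proof (rule W.span_minimal)
    show "\<phi> ` X \<subseteq> \<phi> ` V.span X"
      using V.span_superset by blast
    show "W.subspace (\<phi> ` V.span X)"
    proof (rule W.subspaceI)
      show "0 \<in> \<phi> ` V.span X"
        using hom_zero[OF \<phi>] V.span_zero by (metis image_eqI)
    next
      fix u v assume "u \<in> \<phi> ` V.span X" "v \<in> \<phi> ` V.span X"
      then obtain a b where "u = \<phi> a" "v = \<phi> b" "a \<in> V.span X" "b \<in> V.span X"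
        by blast
      moreover from this have "\<phi> (a + b) = \<phi> a + \<phi> b"
        using sub by (blast intro: hom_add[OF \<phi>])
      ultimately show "u + v \<in> \<phi> ` V.span X"
        by (metis V.span_add image_eqI)
    next
      fix c v assume "v \<in> \<phi> ` V.span X"
      then obtain a where "v = \<phi> a" "a \<in> V.span X"
        by blast
      moreover from this have "\<phi> (smul V c a) = smul W c (\<phi> a)"
        using sub by (blast intro: hom_smul[OF \<phi>])
      ultimately show "smul W c v \<in> \<phi> ` V.span X"
        by (metis V.span_scale image_eqI)
    qed
  qed
qed

lemma hom_image_subspace:
  assumes \<phi>: "\<phi> \<in> hom_gr A V W p"
  shows "W.subspace (\<phi> ` carr V)"
proof -
  have "V.span (carr V) = carr V"
    using V.subspace_carr by (rule V.span_eq_iff[THEN iffD2])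
  then show ?thesis
    using hom_image_span[OF \<phi>, of "carr V"] W.subspace_span by (metis order_refl)
qed

lemma hom_image_submodule:
  assumes \<phi>: "\<phi> \<in> hom_gr A V W p"
  shows "graded_submodule A W (\<phi> ` carr V)"
  unfolding graded_submodule_def
proof (intro conjI ballI)
  let ?S = "\<phi> ` carr V"
  show sub: "W.subspace ?S"
    using \<phi> by (rule hom_image_subspace)
  interpret S: graded_space "\<lambda>p. gr W p \<inter> ?S"
    using sub by unfold_locales
      (auto simp: W.gr.zero_mem W.subspace_0 intro: W.gr.add_mem W.gr.uminus_mem W.gr.independent
        W.subspace_add W.subspace_neg)
  show "?S = gtotal (\<lambda>p. gr W p \<inter> ?S)"
  proof
    show "?S \<subseteq> gtotal (\<lambda>p. gr W p \<inter> ?S)"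
    proof (rule image_subsetI)
      fix v assume "v \<in> carr V"
      then show "\<phi> v \<in> gtotal (\<lambda>p. gr W p \<inter> ?S)"
      proof (induction v rule: V.gr.gtotal_induct)
        case (homogeneous j v)
        then have "\<phi> v \<in> gr W (p + j) \<inter> ?S"
          using \<phi> V.gr.gtotal_mem by (blast intro: hom_homogeneous)
        then show ?case by (rule S.gtotal_mem)
      qed (simp add: hom_add[OF \<phi>] S.gtotal_add)
    qed
    show "gtotal (\<lambda>p. gr W p \<inter> ?S) \<subseteq> ?S"
    proof
      fix w assume "w \<in> gtotal (\<lambda>p. gr W p \<inter> ?S)"
      then show "w \<in> ?S"
        by (rule gtotal_cases) (metis IntD2 W.subspace_add sub)
    qed
  qed
  fix x w assume x: "x \<in> A" and "w \<in> ?S"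
  then obtain v where "v \<in> carr V" "w = \<phi> v" by blast
  \<comment> \<open>The twist is an involution, so the twisted commutation rule can be read
    backwards; this shows stability for odd \<open>\<phi>\<close> and inhomogeneous \<open>x\<close>
    as well.\<close>
  moreover from this x have "act W x (\<phi> v) = \<phi> (act V (uq_twist p x) v)"
    using \<phi> by (simp add: hom_act_twist uq_twist_mem sub_superalgebra_axioms)
  ultimately show "act W x w \<in> ?S"
    using x by (simp add: V.act_carr sub_superalgebra_axioms uq_twist_mem)
qed

end

lemma sub_mod_simps [simp]:
  "gr (sub_mod M S) = (\<lambda>p. gr M p \<inter> S)" "smul (sub_mod M S) = smul M" "act (sub_mod M S) = act M"
  by (simp_all add: sub_mod_def)

lemma supermodule_sub_mod:
  assumes "supermodule A M" "graded_submodule A M S"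
  shows "supermodule A (sub_mod M S)"
proof -
  interpret supermodule A M by fact
  have S: "subspace S" "gtotal (\<lambda>p. gr M p \<inter> S) = S" "\<And>x v. x \<in> A \<Longrightarrow> v \<in> S \<Longrightarrow> act M x v \<in> S"
    using assms(2) by (auto simp: graded_submodule_def)
  have carr: "S \<subseteq> carr M"
    using gtotal_mono[of "\<lambda>p. gr M p \<inter> S" "gr M"] S(2) by auto
  interpret sub: vector_space "smul (sub_mod M S)"
    by (simp add: vector_space_axioms)
  have "sub.subspace (gr (sub_mod M S) p)" for p
    using subspace_inter[OF gr_subspace[of p] S(1)] unfolding sub.subspace_def subspace_def by simp
  moreover have "gr M 0 \<inter> S \<inter> (gr M 1 \<inter> S) = {0}"
    using gr_independent subspace_0[OF S(1)] by auto
  ultimately show ?thesis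
    using carr S(3)
    by unfold_locales
      (auto simp: S(2) act_homogeneous act_add_right act_smul_right act_add_left act_scale_left
        act_mult act_one subset_iff)
qed

context supermodule_pair
begin

text \<open>A homomorphism of either parity preserves weights and carries the \<open>K\<close>-orbit
  of \<open>v\<close> onto that of \<open>\<phi> v\<close>, so generating vectors of the required
  kind go to generating vectors of the same kind.\<close>

lemma in_cat_hom_image:
  assumes \<phi>: "\<phi> \<in> hom_gr A V W p" and V: "in_cat A K V" and K: "sub_superalgebra K" "K \<subseteq> A"
    and uK: "\<And>b. b \<in> {1..CARD('m) + CARD('n)} \<Longrightarrow> uK b \<in> A"
  shows "in_cat A K (sub_mod W (\<phi> ` carr V))"
proof -
  let ?S = "\<phi> ` carr V"
  define X where "X = {v. (\<exists>\<mu>. weight_vector V \<mu> v) \<and> (\<exists>B. finite B \<and> {act V x v | x. x \<in> K} = V.span B)}"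
  define Y where "Y = {v. (\<exists>\<mu>. weight_vector (sub_mod W ?S) \<mu> v) \<and>
    (\<exists>B. finite B \<and> {act W x v | x. x \<in> K} = W.span B)}"
  have S: "gtotal (\<lambda>p. gr W p \<inter> ?S) = ?S"
    using hom_image_submodule[OF \<phi>] by (simp add: graded_submodule_def)
  have X: "X \<subseteq> carr V"
    by (auto simp: X_def weight_vector_def)
  have span: "carr V = V.span X"
    using V by (simp add: in_cat_def X_def)
  have "\<phi> v \<in> Y" if "v \<in> X" for v
  proof -
    from that obtain \<mu> B where \<mu>: "weight_vector V \<mu> v" and B: "finite B" "{act V x v | x. x \<in> K} = V.span B"
      unfolding X_def by blast
    then have v: "v \<in> carr V" by (simp add: weight_vector_def)
    \<comment> \<open>Being even, \<open>uK a\<close> commutes with \<open>\<phi>\<close> without a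
      sign, so the weight is unchanged even for odd \<open>\<phi>\<close>.\<close>
    have "(uK a :: ('m, 'n) uq) \<in> uq_gr 0" if "a \<in> {1..CARD('m) + CARD('n)}" for a
      using uq_sgn_K(1)[OF that] by (simp add: uq_gr_iff)
    then have "act W (uK a) (\<phi> v) = \<phi> (act V (uK a) v)" if "a \<in> {1..CARD('m) + CARD('n)}" for a
      using that hom_act[OF \<phi> uK[OF that] _ v, of 0] by simp
    then have "weight_vector (sub_mod W ?S) \<mu> (\<phi> v)"
      using \<mu> v unfolding weight_vector_def
      by (simp only: sub_mod_simps S) (simp add: hom_smul[OF \<phi>])
    \<comment> \<open>Individual elements are twisted, but the twist permutes \<open>K\<close>, so
      the orbits correspond as sets.\<close>
    moreover have "{act W x (\<phi> v) | x. x \<in> K} = \<phi> ` {act V x v | x. x \<in> K}"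
    proof -
      have "act W x (\<phi> v) = \<phi> (act V (uq_twist p x) v)" if "x \<in> A" for x
        using that \<phi> v by (simp add: hom_act_twist uq_twist_mem sub_superalgebra_axioms)
      then have *: "act W x (\<phi> v) = \<phi> (act V (uq_twist p x) v)" if "x \<in> K" for x
        using that K(2) by blast
      show ?thesis
      proof (intro equalityI subsetI)
        fix w assume "w \<in> {act W x (\<phi> v) | x. x \<in> K}"
        then show "w \<in> \<phi> ` {act V x v | x. x \<in> K}"
          using * uq_twist_mem[OF K(1)] by blast
      next
        fix w assume "w \<in> \<phi> ` {act V x v | x. x \<in> K}"
        then obtain x where x: "x \<in> K" "w = \<phi> (act V x v)" by blast
        then have "w = act W (uq_twist p x) (\<phi> v)"
          using *[OF uq_twist_mem[OF K(1) x(1), of p]] by simp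
        then show "w \<in> {act W x (\<phi> v) | x. x \<in> K}"
          using uq_twist_mem[OF K(1) x(1)] by blast
      qed
    qed
    moreover have "B \<subseteq> carr V"
    proof -
      have "{act V x v | x. x \<in> K} \<subseteq> carr V"
        using K(2) v by (auto intro: V.act_carr[OF sub_superalgebra_axioms])
      then show ?thesis using B(2) V.span_superset by blast
    qed
    ultimately show ?thesis
      using B hom_image_span[OF \<phi>, of B] unfolding Y_def by auto
  qed
  then have "\<phi> ` X \<subseteq> Y"
    by blast
  moreover have "?S = W.span (\<phi> ` X)"
    using hom_image_span[OF \<phi> X] span by simp
  ultimately have "?S \<subseteq> W.span Y"
    using W.span_mono by blast
  \<comment> \<open>Weight vectors of the submodule lie in its carrier by definition, and the
    carrier is a subspace.\<close>
  moreover have "W.span Y \<subseteq> ?S"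
    by (rule W.span_minimal) (auto simp: Y_def weight_vector_def S hom_image_subspace[OF \<phi>])
  ultimately have "?S = W.span Y" by (rule equalityI)
  moreover have "supermodule A (sub_mod W ?S)"
    using W.supermodule_axioms hom_image_submodule[OF \<phi>] by (rule supermodule_sub_mod)
  ultimately show ?thesis
    unfolding in_cat_def sub_mod_simps S Y_def by (intro conjI)
qed

end

section \<open>The coinduced supermodule\<close>

locale coinduction =
  Q: sub_superalgebra Q + P: sub_superalgebra P + V: supermodule P V
  for Q P :: "('m::finite, 'n::finite) uq set"
    and V :: "('m, 'n, 'v::ab_group_add) supermod" +
  assumes subset: "P \<subseteq> Q"
begin

abbreviation "R \<equiv> regular_mod Q"
abbreviation "M \<equiv> coind Q P V"
abbreviation "H \<equiv> hom_gr P R V"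

lemma R_simps [simp]: "gr R = (\<lambda>p. Q \<inter> uq_gr p)" "smul R = uq_scale" "act R = (*)"
  by (simp_all add: regular_mod_def)

sublocale H: supermodule_pair P R V
  by (intro supermodule_pairI P.sub_superalgebra_axioms V.supermodule_axioms supermodule_regular_mod
      Q.sub_superalgebra_axioms subset)

lemma M_simps [simp]: "gr M = H" "smul M = hom_smul V"
  by (simp_all add: coind_def Let_def)

lemmas hom = H.gtotal_hom_add[simplified] H.gtotal_hom_smul[simplified]
  H.gtotal_hom_outside[simplified] H.gtotal_hom_zero H.gtotal_hom_carr

lemma M_act:
  "x \<in> Q \<Longrightarrow> act M y \<zeta> x = (\<Sum>i \<in> {0, 1}. \<Sum>j \<in> {0, 1}. \<Sum>k \<in> {0, 1}.
     ksign (i * (j + k)) (gproj H k \<zeta> (gproj uq_gr j x * gproj uq_gr i y)))"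
  "x \<notin> Q \<Longrightarrow> act M y \<zeta> x = 0"
  by (simp_all add: coind_def Let_def)

lemma gproj_H: "\<zeta> \<in> gtotal H \<Longrightarrow> gproj H k \<zeta> \<in> gtotal H"
  by (intro H.hom.gtotal_mem[OF H.hom.gproj_split(1)])

text \<open>All but one of the eight summands vanish, since the other projections of
  \<open>x\<close>, \<open>y\<close> or \<open>\<zeta>\<close> are 0. All sign computations in
  \<open>coind\<close> go through this form.\<close>

lemma M_act_homogeneous:
  assumes "y \<in> Q" "y \<in> uq_gr i" "x \<in> Q" "x \<in> uq_gr j" "\<zeta> \<in> H k"
  shows "act M y \<zeta> x = ksign (i * (j + k)) (\<zeta> (x * y))"
  using assms
  by (cases i; cases j; cases k)
    (simp_all add: M_act uq_gr.gproj_homogeneous H.hom.gproj_homogeneous H.hom_zero)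

lemma M_act_add_argument:
  assumes "\<zeta> \<in> gtotal H" "y \<in> Q" "x \<in> Q" "x' \<in> Q"
  shows "act M y \<zeta> (x + x') = act M y \<zeta> x + act M y \<zeta> x'"
proof -
  have mem: "gproj uq_gr j x * gproj uq_gr i y \<in> Q" if "x \<in> Q" for x i j
    using that assms Q.gproj_uq_gr by (blast intro: Q.times_mem)
  show ?thesis
    using assms mem
    by (simp only: M_act Q.plus_mem uq_gr.gproj_add Q.gtotal_uq_gr distrib_right hom gproj_H
        ksign_add sum.distrib)
qed

lemma M_act_add_left:
  assumes "\<zeta> \<in> gtotal H" "y \<in> Q" "y' \<in> Q"
  shows "act M (y + y') \<zeta> = act M y \<zeta> + act M y' \<zeta>"
proof
  fix x
  have mem: "gproj uq_gr j x * gproj uq_gr i y \<in> Q" if "x \<in> Q" "y \<in> Q" for y i j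
    using that Q.gproj_uq_gr by (blast intro: Q.times_mem)
  show "act M (y + y') \<zeta> x = (act M y \<zeta> + act M y' \<zeta>) x"
  proof (cases "x \<in> Q")
    case True
    then show ?thesis
      using assms mem
      by (simp only: M_act plus_fun_apply uq_gr.gproj_add Q.gtotal_uq_gr distrib_left hom gproj_H
          ksign_add sum.distrib)
  qed (simp add: M_act)
qed

lemma M_act_add_right:
  assumes "\<zeta> \<in> gtotal H" "\<zeta>' \<in> gtotal H"
  shows "act M y (\<zeta> + \<zeta>') = act M y \<zeta> + act M y \<zeta>'"
proof
  fix x
  show "act M y (\<zeta> + \<zeta>') x = (act M y \<zeta> + act M y \<zeta>') x"
  proof (cases "x \<in> Q")
    case True
    then show ?thesis
      using assms
      by (simp only: M_act plus_fun_apply H.hom.gproj_add ksign_add sum.distrib)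
  qed (simp add: M_act)
qed

text \<open>Left multiplication by \<open>P\<close> and right multiplication by \<open>y\<close>
  commute by associativity. The signs agree because \<open>i * (l + j + k) + l * k\<close> equals
  \<open>l * (i + k) + i * (j + k)\<close> modulo 2.\<close>

lemma M_act_mem_homogeneous:
  assumes y: "y \<in> Q" "y \<in> uq_gr i" and \<zeta>: "\<zeta> \<in> H k"
  shows "act M y \<zeta> \<in> H (i + k)"
proof (rule H.hom_grI; (unfold R_simps Q.gtotal_eq)?)
  show "act M y \<zeta> (u + v) = act M y \<zeta> u + act M y \<zeta> v" if "u \<in> Q" "v \<in> Q" for u v
    using that y H.hom.gtotal_mem[OF \<zeta>] by (simp add: M_act_add_argument)
next
  fix c x j assume x: "x \<in> Q \<inter> uq_gr j"
  show "act M y \<zeta> (uq_scale c x) = smul V c (act M y \<zeta> x)"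
    using x y \<zeta> H.hom_smul[OF \<zeta>, of "x * y" c]
    by (simp add: M_act_homogeneous[of y i _ j \<zeta> k] Q.scale_mem Q.times_mem uq_gr_scale
        uq_scale_mult_left V.smul_ksign)
  show "act M y \<zeta> x \<in> gr V (i + k + j)"
    using x y \<zeta> H.hom_homogeneous[OF \<zeta>, of "x * y" "j + i"] uq_gr_mult[of x j y i]
    by (simp add: M_act_homogeneous[of y i _ j \<zeta> k] Q.times_mem V.gr.ksign_mem add_ac)
next
  fix x l v j assume x: "x \<in> P" "x \<in> uq_gr l" and v: "v \<in> Q \<inter> uq_gr j"
  have "\<zeta> (x * v * y) = ksign (l * k) (act V x (\<zeta> (v * y)))"
    using x v y H.hom_act[OF \<zeta> x, of "v * y"] by (simp add: Q.times_mem mult.assoc)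
  moreover have xv: "x * v \<in> Q" "x * v \<in> uq_gr (l + j)"
    using x v subset by (auto intro: Q.times_mem uq_gr_mult)
  moreover have "v \<in> Q" "v \<in> uq_gr j"
    using v by simp_all
  ultimately show "act M y \<zeta> (x * v) = ksign (l * (i + k)) (act V x (act M y \<zeta> v))"
    using M_act_homogeneous[OF y xv \<zeta>] M_act_homogeneous[OF y _ _ \<zeta>, of v j] x
    by (simp add: V.act_ksign_right H.hom_carr[OF \<zeta>])
      (cases i; cases j; cases k; cases l; simp add: ksign_def)
qed (simp add: M_act)

lemma M_act_mem:
  assumes "y \<in> Q" "\<zeta> \<in> gtotal H"
  shows "act M y \<zeta> \<in> gtotal H"
  using assms(1)
proof (induction y rule: Q.homogeneous_induct)
  case y: (homogeneous i y)
  show ?case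
    using assms(2)
    by (induction \<zeta> rule: H.hom.gtotal_induct)
      (use y in \<open>blast intro: H.hom.gtotal_mem[OF M_act_mem_homogeneous],
        simp only: M_act_add_right H.hom.gtotal_add\<close>)
qed (metis M_act_add_left assms(2) H.hom.gtotal_add)

text \<open>Elements of the carrier are additive on \<open>Q\<close> and vanish outside it, so
  identities in the coinduced module may be tested at homogeneous arguments.\<close>

lemma fun_eq_on_Q:
  assumes "\<zeta> \<in> gtotal H" "\<zeta>' \<in> gtotal H"
    and "\<And>x j. x \<in> Q \<Longrightarrow> x \<in> uq_gr j \<Longrightarrow> \<zeta> x = \<zeta>' x"
  shows "\<zeta> = \<zeta>'"
proof
  fix x
  show "\<zeta> x = \<zeta>' x"
  proof (cases "x \<in> Q")
    case True
    then show ?thesis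
      by (induction x rule: Q.homogeneous_induct) (simp_all add: assms hom)
  qed (simp add: assms hom)
qed

text \<open>The laws involving scalars, products and 1 are verified for homogeneous data at
  homogeneous arguments, where the action is a signed translation, and then extended by
  additivity.\<close>

sublocale M: supermodule Q M
proof -
  interpret vector_space "smul M"
    using H.hom.vector_space_axioms by simp
  have scale: "hom_smul V c \<zeta> \<in> gtotal H" if "\<zeta> \<in> gtotal H" for c \<zeta>
    using that
    by (induction \<zeta> rule: H.hom.gtotal_induct)
      (blast intro: H.hom.gtotal_mem H.hom.subspace_scale[OF H.hom_gr_subspace],
        simp only: H.hom.scale_right_distrib H.hom.gtotal_add)
  have scale_homogeneous: "hom_smul V c \<zeta> \<in> H k" if "\<zeta> \<in> H k" for c \<zeta> k
    using that by (intro H.hom.subspace_scale[OF H.hom_gr_subspace])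
  show "supermodule Q M"
  proof
    show "subspace (gr M p)" for p
      using H.hom_gr_subspace[of p] by simp
    show "gr M 0 \<inter> gr M 1 = {0}"
      using H.hom.independent H.hom.zero_mem by auto
    show "act M x \<zeta> \<in> gr M (i + j)" if "x \<in> Q \<inter> uq_gr i" "\<zeta> \<in> gr M j" for x \<zeta> i j
      using that by (simp add: M_act_mem_homogeneous)
    show "act M y (\<zeta> + \<zeta>') = act M y \<zeta> + act M y \<zeta>'" if "\<zeta> \<in> carr M" "\<zeta>' \<in> carr M" for y \<zeta> \<zeta>'
      using that by (simp add: M_act_add_right)
    show "act M (x + y) \<zeta> = act M x \<zeta> + act M y \<zeta>" if "x \<in> Q" "y \<in> Q" "\<zeta> \<in> carr M" for x y \<zeta>
      using that by (simp add: M_act_add_left)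
    have homogeneous: "act M y (hom_smul V c \<zeta>) = hom_smul V c (act M y \<zeta>) \<and>
        act M (uq_scale c y) \<zeta> = hom_smul V c (act M y \<zeta>)"
      if y: "y \<in> Q" "y \<in> uq_gr i" and \<zeta>: "\<zeta> \<in> H k" for c y i \<zeta> k
    proof (intro conjI; rule fun_eq_on_Q)
      fix x j assume x: "x \<in> Q" "x \<in> uq_gr j"
      note * = M_act_homogeneous[OF y x \<zeta>]
      show "act M y (hom_smul V c \<zeta>) x = hom_smul V c (act M y \<zeta>) x"
        using M_act_homogeneous[OF y x scale_homogeneous[OF \<zeta>], of c]
        by (simp add: * hom_smul_def V.smul_ksign)
      show "act M (uq_scale c y) \<zeta> x = hom_smul V c (act M y \<zeta>) x"
        using M_act_homogeneous[OF Q.scale_mem[OF y(1), of c] uq_gr_scale[OF y(2)] x \<zeta>]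
          H.hom_smul[OF \<zeta>, of "x * y" c] x y
        by (simp add: * hom_smul_def V.smul_ksign uq_scale_mult_right Q.times_mem)
    qed (use y \<zeta> in \<open>auto intro: scale M_act_mem H.hom.gtotal_mem Q.scale_mem\<close>)
    have linear: "act M y (hom_smul V c \<zeta>) = hom_smul V c (act M y \<zeta>) \<and>
        act M (uq_scale c y) \<zeta> = hom_smul V c (act M y \<zeta>)"
      if "y \<in> Q" "\<zeta> \<in> gtotal H" for c y \<zeta>
      using that(1)
    proof (induction y rule: Q.homogeneous_induct)
      case y: (homogeneous i y)
      show ?case
        using that(2)
        by (induction \<zeta> rule: H.hom.gtotal_induct)
          (use homogeneous[OF y] in \<open>simp_all del: plus_fun_apply add: M_act_add_right H.hom.scale_right_distrib scale\<close>)
    next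
      case (add u w)
      then show ?case
        using that(2)
        by (simp del: plus_fun_apply add: M_act_add_left scale uq.scale_right_distrib H.hom.scale_right_distrib Q.scale_mem)
    qed
    show "act M x (smul M c \<zeta>) = smul M c (act M x \<zeta>)" if "x \<in> Q" "\<zeta> \<in> carr M" for x c \<zeta>
      using that linear by simp
    show "act M (uq_scale c x) \<zeta> = smul M c (act M x \<zeta>)" if "x \<in> Q" "\<zeta> \<in> carr M" for x c \<zeta>
      using that linear by simp
    \<comment> \<open>Acting twice gives the exponent
      \<open>i * (j + l + k) + l * (j + i + k)\<close>. The two mixed terms \<open>i * l\<close>
      cancel modulo 2, which leaves \<open>(i + l) * (j + k)\<close>.\<close>
    have mult: "act M (y * z) \<zeta> = act M y (act M z \<zeta>)"
      if y: "y \<in> Q" "y \<in> uq_gr i" and z: "z \<in> Q" "z \<in> uq_gr l" and \<zeta>: "\<zeta> \<in> H k" for y z \<zeta> i l k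
    proof (rule fun_eq_on_Q)
      fix x j assume x: "x \<in> Q" "x \<in> uq_gr j"
      show "act M (y * z) \<zeta> x = act M y (act M z \<zeta>) x"
        using M_act_homogeneous[OF Q.times_mem[OF y(1) z(1)] uq_gr_mult[OF y(2) z(2)] x \<zeta>]
          M_act_homogeneous[OF y x M_act_mem_homogeneous[OF z \<zeta>]]
          M_act_homogeneous[OF z Q.times_mem[OF x(1) y(1)] uq_gr_mult[OF x(2) y(2)] \<zeta>]
        by (simp add: ksign_ksign mult.assoc)
          (cases i; cases j; cases k; cases l; simp)
    qed (use y z \<zeta> in \<open>auto intro: M_act_mem H.hom.gtotal_mem Q.times_mem\<close>)
    \<comment> \<open>\<open>y\<close> and \<open>z\<close> become arbitrary while
      \<open>\<zeta>\<close> is still homogeneous; the final induction frees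
      \<open>\<zeta>\<close>.\<close>
    have mult': "act M (y * z) \<zeta> = act M y (act M z \<zeta>)"
      if y: "y \<in> Q" and z: "z \<in> Q" and \<zeta>: "\<zeta> \<in> H k" for y z \<zeta> k
      using y
    proof (induction y rule: Q.homogeneous_induct)
      case y: (homogeneous i y)
      show ?case
        using z
        by (induction z rule: Q.homogeneous_induct)
          (use mult[OF y _ _ \<zeta>] y H.hom.gtotal_mem[OF \<zeta>] in
            \<open>simp_all del: plus_fun_apply add: distrib_left M_act_add_left M_act_add_right M_act_mem Q.times_mem\<close>)
    qed (use z H.hom.gtotal_mem[OF \<zeta>] in
        \<open>simp_all del: plus_fun_apply add: distrib_right M_act_add_left M_act_mem Q.times_mem\<close>)
    show "act M (y * z) \<zeta> = act M y (act M z \<zeta>)" if yz: "y \<in> Q" "z \<in> Q" and "\<zeta> \<in> carr M" for y z \<zeta>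
    proof -
      have "\<zeta> \<in> gtotal H" using that(3) by simp
      then show ?thesis
        by (induction \<zeta> rule: H.hom.gtotal_induct)
          (simp_all del: plus_fun_apply add: mult' yz M_act_add_right M_act_mem)
    qed
    have one: "act M 1 \<zeta> = \<zeta>" if "\<zeta> \<in> H k" for \<zeta> k
    proof (rule fun_eq_on_Q)
      fix x j assume "x \<in> Q" "x \<in> uq_gr j"
      then show "act M 1 \<zeta> x = \<zeta> x"
        using M_act_homogeneous[OF Q.one_mem uq_gr_one _ _ that] by simp
    qed (use that in \<open>auto intro: M_act_mem H.hom.gtotal_mem Q.one_mem\<close>)
    have "act M 1 \<zeta> = \<zeta>" if "\<zeta> \<in> gtotal H" for \<zeta>
      using that by (induction \<zeta> rule: H.hom.gtotal_induct)
        (simp_all del: plus_fun_apply add: one M_act_add_right)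
    then show "act M 1 \<zeta> = \<zeta>" if "\<zeta> \<in> carr M" for \<zeta>
      using that by simp
  qed
qed

text \<open>At the even element 1 the action contributes the sign with exponent
  \<open>i * k\<close>, and \<open>P\<close>-linearity of \<open>\<zeta>\<close> contributes the
  same sign; they cancel. Hence evaluation at 1 is \<open>P\<close>-linear without any sign.\<close>

lemma M_act_one:
  assumes "x \<in> P" "\<zeta> \<in> gtotal H"
  shows "act M x \<zeta> 1 = act V x (\<zeta> 1)"
  using assms(1)
proof (induction x rule: P.homogeneous_induct)
  case x: (homogeneous i x)
  show ?case
    using assms(2)
  proof (induction \<zeta> rule: H.hom.gtotal_induct)
    case (homogeneous k \<zeta>)
    have "\<zeta> (x * 1) = ksign (i * k) (act V x (\<zeta> 1))"
      using H.hom_act[OF homogeneous x, of 1] by (simp add: Q.one_mem)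
    then show ?case
      using M_act_homogeneous[OF _ x(2) Q.one_mem uq_gr_one homogeneous] x subset
      by (simp add: ksign_ksign subset_iff)
  next
    case (add \<zeta> \<zeta>')
    then show ?case
      using x by (simp only: M_act_add_right) (simp add: V.act_add_right H.gtotal_hom_carr)
  qed
next
  case (add u w)
  then show ?case
    using assms(2) subset by (simp add: M_act_add_left V.act_add_left hom subset_iff)
qed

end

section \<open>Frobenius reciprocity\<close>

lemma ksign_apply: "ksign p f x = ksign p (f x)"
  by (simp add: ksign_def)

locale reciprocity = coinduction Q P V + W: supermodule Q W
  for Q P :: "('m::finite, 'n::finite) uq set"
    and V :: "('m, 'n, 'v::ab_group_add) supermod"
    and W :: "('m, 'n, 'w::ab_group_add) supermod"
begin

sublocale QW: supermodule_pair Q W M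
  by (intro supermodule_pairI Q.sub_superalgebra_axioms W.supermodule_axioms M.supermodule_axioms)

sublocale PW: supermodule_pair P "forget P W" V
  by (intro supermodule_pairI P.sub_superalgebra_axioms V.supermodule_axioms supermodule_forget[of Q]
      W.supermodule_axioms subset)

abbreviation "QHom \<equiv> hom_gr Q W M"
abbreviation "PHom \<equiv> hom_gr P (forget P W) V"

lemma QHom_value: "\<phi> \<in> QHom p \<Longrightarrow> w \<in> gr W k \<Longrightarrow> \<phi> w \<in> H (p + k)"
  using QW.hom_homogeneous by simp

text \<open>As 1 is even, evaluation there keeps the parity, and by \<open>M_act_one\<close> the
  only sign left is the one that belongs to \<open>\<phi>\<close>.\<close>

lemma eval_one_hom:
  assumes \<phi>: "\<phi> \<in> QHom p"
  shows "eval_one \<phi> \<in> PHom p"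
proof (rule PW.hom_grI; (unfold gr_forget smul_forget)?)
  show "eval_one \<phi> (u + v) = eval_one \<phi> u + eval_one \<phi> v" if "u \<in> carr W" "v \<in> carr W" for u v
    using QW.hom_add[OF \<phi> that] by (simp add: eval_one_def)
next
  fix c w k assume w: "w \<in> gr W k"
  show "eval_one \<phi> (smul W c w) = smul V c (eval_one \<phi> w)"
    using QW.hom_smul[OF \<phi> W.gr.gtotal_mem[OF w]] by (simp add: eval_one_def hom_smul_def)
  show "eval_one \<phi> w \<in> gr V (p + k)"
    using H.hom_homogeneous[OF QHom_value[OF \<phi> w], of 1 0]
    by (simp add: eval_one_def Q.one_mem uq_gr_one)
next
  fix x i w k assume x: "x \<in> P" "x \<in> uq_gr i" and w: "w \<in> gr W k"
  have "x \<in> Q" using x subset by blast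
  then have "\<phi> (act W x w) = ksign (i * p) (act M x (\<phi> w))"
    using QW.hom_act[OF \<phi> _ x(2) W.gr.gtotal_mem[OF w]] by simp
  then show "eval_one \<phi> (act (forget P W) x w) = ksign (i * p) (act V x (eval_one \<phi> w))"
    using M_act_one[OF x(1) H.hom.gtotal_mem[OF QHom_value[OF \<phi> w]]] x
    by (simp add: eval_one_def act_forget ksign_apply)
qed (simp add: eval_one_def QW.hom_outside[OF \<phi>])

text \<open>Up to sign, the value of \<open>\<phi> w\<close> at \<open>x\<close> is the value at 1
  of \<open>x\<close> acting on \<open>\<phi> w\<close>, hence that of \<open>\<phi>\<close> at
  \<open>x w\<close>. So the values at 1 determine \<open>\<phi>\<close>.\<close>

lemma eval_one_zero_imp_zero:
  assumes \<phi>: "\<phi> \<in> QHom p" and zero: "eval_one \<phi> = 0"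
  shows "\<phi> = 0"
proof
  fix w
  have homogeneous: "\<phi> w = 0" if w: "w \<in> gr W k" for w k
  proof (rule fun_eq_on_Q)
    show "\<phi> w \<in> gtotal H"
      using QHom_value[OF \<phi> w] by (rule H.hom.gtotal_mem)
    fix x i assume x: "x \<in> Q" "x \<in> uq_gr i"
    have "\<phi> (act W x w) 1 = 0"
      using zero by (metis eval_one_def zero_fun_apply)
    then have "act M x (\<phi> w) 1 = 0"
      using QW.hom_act[OF \<phi> x W.gr.gtotal_mem[OF w]] by (simp add: ksign_def split: if_splits)
    then show "\<phi> w x = 0 x"
      using M_act_homogeneous[OF x Q.one_mem uq_gr_one QHom_value[OF \<phi> w]]
      by (simp add: ksign_def split: if_splits)
  qed (rule H.hom.gtotal_zero)
  show "\<phi> w = 0 w"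
  proof (cases "w \<in> carr W")
    case True
    then show ?thesis
      by (induction w rule: W.gr.gtotal_induct) (simp_all add: homogeneous QW.hom_add[OF \<phi>])
  qed (simp add: QW.hom_outside[OF \<phi>])
qed

text \<open>The inverse of evaluation at \<open>1\<close>: \<open>\<langle>\<phi>(w), x\<rangle> = (-1)\<^bsup>[x][w]\<^esup> \<psi>(xw)\<close>. The sign is forced by
  \<open>\<psi>(xw) = \<phi>(xw)(1) = (-1)\<^bsup>[x][\<phi>]\<^esup> (x\<phi>(w))(1) = (-1)\<^bsup>[x][w]\<^esup> \<langle>\<phi>(w), x\<rangle>\<close>.\<close>

definition coeval :: "('w \<Rightarrow> 'v) \<Rightarrow> 'w \<Rightarrow> ('m, 'n) uq \<Rightarrow> 'v" where
  "coeval \<psi> w x = (if w \<in> carr W \<and> x \<in> Q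
     then \<Sum>k \<in> {0, 1}. \<psi> (act W (uq_twist k x) (gproj (gr W) k w)) else 0)"

context
  fixes \<psi> p
  assumes \<psi>: "\<psi> \<in> PHom p"
begin

text \<open>Twisting by the parity of \<open>w\<close> expresses the sign without splitting
  \<open>x\<close>, which makes additivity in \<open>x\<close> immediate; the summand for the other
  parity of \<open>w\<close> is 0.\<close>

lemma coeval_twist:
  assumes "w \<in> gr W k" "x \<in> Q"
  shows "coeval \<psi> w x = \<psi> (act W (uq_twist k x) w)"
  using assms PW.hom_zero[OF \<psi>]
  by (cases k) (simp_all add: coeval_def W.gr.gtotal_mem W.gr.gproj_homogeneous W.act_zero_right
      uq_twist_mem Q.sub_superalgebra_axioms)

lemma coeval_homogeneous:
  assumes "w \<in> gr W k" "x \<in> Q" "x \<in> uq_gr j"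
  shows "coeval \<psi> w x = ksign (j * k) (\<psi> (act W x w))"
proof -
  have w: "w \<in> carr W" using assms(1) by (rule W.gr.gtotal_mem)
  then have "\<psi> (- act W x w) = - \<psi> (act W x w)"
    using assms by (intro PW.hom_uminus[OF \<psi>]) (simp add: W.act_carr Q.sub_superalgebra_axioms)
  then show ?thesis
    using assms w
    by (simp add: coeval_twist uq_twist_homogeneous W.act_ksign_left) (simp add: ksign_def)
qed

text \<open>Moving \<open>y\<close> out of \<open>\<psi>\<close> gives the exponent
  \<open>l * p\<close>, and the parity \<open>l + j\<close> of the product gives
  \<open>(l + j) * k\<close>. Together they are \<open>l * (p + k) + j * k\<close>, as
  \<open>P\<close>-linearity in parity \<open>p + k\<close> demands.\<close>

lemma coeval_value:
  assumes w: "w \<in> gr W k"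
  shows "coeval \<psi> w \<in> H (p + k)"
proof (rule H.hom_grI; (unfold R_simps Q.gtotal_eq)?)
  have carr: "w \<in> carr W" using w by (rule W.gr.gtotal_mem)
  have act_carr: "act W x w \<in> carr W" if "x \<in> Q" for x
    using that carr by (simp add: W.act_carr Q.sub_superalgebra_axioms)
  show "coeval \<psi> w (x + y) = coeval \<psi> w x + coeval \<psi> w y" if "x \<in> Q" "y \<in> Q" for x y
    using that w carr PW.hom_add[OF \<psi>]
    by (simp add: coeval_twist Q.plus_mem uq_twist_add W.act_add_left uq_twist_mem act_carr
        Q.sub_superalgebra_axioms)
  show "coeval \<psi> w (uq_scale c x) = smul V c (coeval \<psi> w x)" if "x \<in> Q \<inter> uq_gr j" for c x j
    using that w carr PW.hom_smul[OF \<psi>, of "act W x w" c]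
    by (simp add: coeval_homogeneous[of w k _ j] Q.scale_mem uq_gr_scale W.act_scale_left act_carr
        V.smul_ksign)
  show "coeval \<psi> w x \<in> gr V (p + k + j)" if "x \<in> Q \<inter> uq_gr j" for x j
    using that w PW.hom_homogeneous[OF \<psi>, of "act W x w" "j + k"]
    by (simp add: coeval_homogeneous[of w k _ j] W.act_homogeneous V.gr.ksign_mem add_ac)
  show "coeval \<psi> w (y * x) = ksign (l * (p + k)) (act V y (coeval \<psi> w x))"
    if y: "y \<in> P" "y \<in> uq_gr l" and x: "x \<in> Q \<inter> uq_gr j" for y l x j
  proof -
    have "y \<in> Q" using y subset by blast
    then have "coeval \<psi> w (y * x) = ksign ((l + j) * k) (\<psi> (act W y (act W x w)))"
      using coeval_homogeneous[OF w Q.times_mem uq_gr_mult, of y x l j] x y carr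
      by (simp add: W.act_mult)
    also have "\<psi> (act W y (act W x w)) = ksign (l * p) (act V y (\<psi> (act W x w)))"
      using PW.hom_act[OF \<psi> y, of "act W x w"] x y by (simp add: act_forget act_carr)
    finally show ?thesis
      using x y w coeval_homogeneous[OF w, of x j] V.act_ksign_right[OF y(1) PW.hom_carr[OF \<psi>]]
      by (simp add: ksign_ksign) (cases l; cases j; cases k; cases p; simp)
  qed
qed (simp add: coeval_def)

lemma coeval_add:
  assumes "u \<in> carr W" "w \<in> carr W"
  shows "coeval \<psi> (u + w) = coeval \<psi> u + coeval \<psi> w"
proof
  fix x
  have "act W (uq_twist k x) (gproj (gr W) k v) \<in> carr W" if "x \<in> Q" "v \<in> carr W" for k v
    using that by (simp add: W.act_carr Q.sub_superalgebra_axioms uq_twist_mem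
        W.gr.gtotal_mem[OF W.gr.gproj_split(1)])
  then show "coeval \<psi> (u + w) x = (coeval \<psi> u + coeval \<psi> w) x"
    using assms PW.hom_add[OF \<psi>]
    by (simp add: coeval_def W.gr.gtotal_add W.gr.gproj_add W.act_add_right uq_twist_mem
        Q.sub_superalgebra_axioms W.gr.gtotal_mem[OF W.gr.gproj_split(1)])
qed

lemma coeval_hom: "coeval \<psi> \<in> QHom p"
proof (rule QW.hom_grI)
  fix c w k assume w: "w \<in> gr W k"
  show "coeval \<psi> (smul W c w) = smul M c (coeval \<psi> w)"
  proof
    fix x
    have "smul W c w \<in> gr W k"
      using w W.gr_subspace by (simp add: W.subspace_scale)
    moreover have "act W (uq_twist k x) w \<in> carr W" if "x \<in> Q"
      using that w by (simp add: W.act_carr Q.sub_superalgebra_axioms uq_twist_mem W.gr.gtotal_mem)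
    ultimately show "coeval \<psi> (smul W c w) x = smul M c (coeval \<psi> w) x"
      using w PW.hom_smul[OF \<psi>, of "act W (uq_twist k x) w" c]
      by (cases "x \<in> Q") (simp_all add: hom_smul_def coeval_twist W.act_smul_right uq_twist_mem
          Q.sub_superalgebra_axioms W.gr.gtotal_mem, simp add: coeval_def)
  qed
  show "coeval \<psi> w \<in> gr M (p + k)"
    using coeval_value[OF w] by simp
next
  fix y i w k assume y: "y \<in> Q" "y \<in> uq_gr i" and w: "w \<in> gr W k"
  show "coeval \<psi> (act W y w) = ksign (i * p) (act M y (coeval \<psi> w))"
  proof (rule fun_eq_on_Q)
    have yw: "act W y w \<in> gr W (i + k)"
      using y w by (rule W.act_homogeneous)
    show "coeval \<psi> (act W y w) \<in> gtotal H"
      using coeval_value[OF yw] by (rule H.hom.gtotal_mem)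
    show "ksign (i * p) (act M y (coeval \<psi> w)) \<in> gtotal H"
      by (intro H.hom.gtotal_ksign M_act_mem y H.hom.gtotal_mem[OF coeval_value[OF w]])
    fix x j assume x: "x \<in> Q" "x \<in> uq_gr j"
    \<comment> \<open>Both sides become a signed \<open>\<psi>\<close> of this vector. On the right
      the terms \<open>i * p\<close> and \<open>i * k\<close> each occur twice and cancel, leaving
      \<open>j * (i + k)\<close>, the exponent on the left.\<close>
    have "act W x (act W y w) = act W (x * y) w"
      using x y W.gr.gtotal_mem[OF w] by (simp add: W.act_mult)
    then show "coeval \<psi> (act W y w) x = ksign (i * p) (act M y (coeval \<psi> w)) x"
      using M_act_homogeneous[OF y x coeval_value[OF w]] coeval_homogeneous[OF yw x]
        coeval_homogeneous[OF w Q.times_mem[OF x(1) y(1)] uq_gr_mult[OF x(2) y(2)]]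
      by (simp add: ksign_apply ksign_ksign) (cases i; cases j; cases k; cases p; simp)
  qed
qed (use coeval_add in \<open>auto simp: coeval_def\<close>)

lemma eval_one_coeval: "eval_one (coeval \<psi>) = \<psi>"
proof
  fix w
  show "eval_one (coeval \<psi>) w = \<psi> w"
  proof (cases "w \<in> carr W")
    case True
    then show ?thesis
    proof (induction w rule: W.gr.gtotal_induct)
      case (homogeneous k w)
      then show ?case
        using coeval_homogeneous[OF homogeneous Q.one_mem uq_gr_one]
        by (simp add: eval_one_def W.act_one W.gr.gtotal_mem)
    next
      case (add u w)
      then show ?case
        using PW.hom_add[OF \<psi>] by (simp add: eval_one_def coeval_add)
    qed
  next
    case False
    then show ?thesis
      using PW.hom_outside[OF \<psi>] by (simp add: eval_one_def coeval_def)
  qed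
qed

end

lemma eval_one_add: "eval_one (\<phi> + \<phi>') = eval_one \<phi> + eval_one \<phi>'"
  by (simp add: eval_one_def fun_eq_iff)

lemma even_iso_eval_one: "even_iso (hom_smul M) QHom (hom_smul V) PHom eval_one"
  unfolding even_iso_def bij_betw_def
proof (intro conjI allI ballI)
  show "eval_one (hom_smul M c \<phi>) = hom_smul V c (eval_one \<phi>)" for c \<phi>
    by (simp add: eval_one_def hom_smul_def)
  show "eval_one ` QHom p \<subseteq> PHom p" for p
    using eval_one_hom by blast
  show "inj_on eval_one (gtotal QHom)"
  proof (rule inj_onI)
    fix \<phi> \<phi>' assume \<phi>: "\<phi> \<in> gtotal QHom" "\<phi>' \<in> gtotal QHom" and eq: "eval_one \<phi> = eval_one \<phi>'"
    have "\<phi> + - \<phi>' \<in> gtotal QHom"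
      using \<phi> by (intro QW.hom.gtotal_add QW.hom.gtotal_uminus)
    then obtain \<alpha> \<beta> where \<alpha>\<beta>: "\<alpha> \<in> QHom 0" "\<beta> \<in> QHom 1" "\<phi> + - \<phi>' = \<alpha> + \<beta>"
      by (rule gtotal_cases)
    have "eval_one \<alpha> + eval_one \<beta> = 0"
      using arg_cong[OF \<alpha>\<beta>(3), of eval_one] eq
      by (simp add: eval_one_def fun_eq_iff)
    \<comment> \<open>\<open>eval_one \<alpha>\<close> is even, and odd as the negative of
      \<open>eval_one \<beta>\<close>; so it is 0 and injectivity reduces to the homogeneous
      case.\<close>
    then have "eval_one \<alpha> = - eval_one \<beta>"
      by (simp add: add_eq_0_iff2)
    then have "eval_one \<alpha> \<in> PHom 1"
      using eval_one_hom[OF \<alpha>\<beta>(2)] PW.hom.uminus_mem by simp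
    then have "eval_one \<alpha> = 0"
      using eval_one_hom[OF \<alpha>\<beta>(1)] by (rule PW.hom.independent[rotated])
    moreover from this have "eval_one \<beta> = 0"
      using \<open>eval_one \<alpha> + eval_one \<beta> = 0\<close> by simp
    ultimately have "\<alpha> = 0" "\<beta> = 0"
      using \<alpha>\<beta> eval_one_zero_imp_zero by blast+
    then show "\<phi> = \<phi>'"
      using \<alpha>\<beta>(3) by (simp add: eq_neg_iff_add_eq_0)
  qed
  show "eval_one ` gtotal QHom = gtotal PHom"
  proof
    show "eval_one ` gtotal QHom \<subseteq> gtotal PHom"
    proof (rule image_subsetI)
      fix \<phi> assume "\<phi> \<in> gtotal QHom"
      then show "eval_one \<phi> \<in> gtotal PHom"
        by (rule gtotal_cases)
          (simp add: eval_one_add PW.hom.gtotal_add PW.hom.gtotal_mem[OF eval_one_hom])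
    qed
    show "gtotal PHom \<subseteq> eval_one ` gtotal QHom"
    proof
      fix \<psi> assume "\<psi> \<in> gtotal PHom"
      then obtain \<alpha> \<beta> where \<alpha>\<beta>: "\<alpha> \<in> PHom 0" "\<beta> \<in> PHom 1" "\<psi> = \<alpha> + \<beta>"
        by (rule gtotal_cases)
      \<comment> \<open>The properties of \<open>coeval\<close> are established for maps of a fixed
        parity, so the preimage is assembled from the two components.\<close>
      then have "\<psi> = eval_one (coeval \<alpha> + coeval \<beta>)"
        by (simp add: eval_one_add eval_one_coeval)
      moreover have "coeval \<alpha> + coeval \<beta> \<in> gtotal QHom"
        using \<alpha>\<beta> by (intro QW.hom.gtotal_add QW.hom.gtotal_mem[OF coeval_hom])
      ultimately show "\<psi> \<in> eval_one ` gtotal QHom"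
        by (rule image_eqI)
    qed
  qed
qed (rule eval_one_add)

end

section \<open>The induction functor\<close>

context coinduction
begin

abbreviation ind_space :: "('m, 'n) uq set \<Rightarrow> (('m, 'n) uq \<Rightarrow> 'v) set" where
  "ind_space K \<equiv> H.hom.span (\<Union>{S. graded_submodule Q M S \<and> in_cat Q K (sub_mod M S)})"

lemma ind_eq: "ind Q K P V = sub_mod M (ind_space K)"
  by (simp add: ind_def Let_def)

lemma graded_space_ind: "graded_space (gr (ind Q K P V))"
  by unfold_locales
    (auto simp: ind_eq H.hom.span_zero H.hom.zero_mem
      intro: H.hom.span_add H.hom.span_neg H.hom.add_mem H.hom.uminus_mem H.hom.independent)

end

context reciprocity
begin

text \<open>Action and scalars of \<open>ind\<close> are those of \<open>coind\<close>, so only the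
  condition on values differs. It holds automatically: the image of \<open>W\<close> is one of the
  submodules whose sum is taken.\<close>

lemma hom_gr_ind:
  assumes W: "in_cat Q K W" and QK: "quantum_pair Q K"
  shows "hom_gr Q W (ind Q K P V) = QHom"
proof
  fix p
  have K: "sub_superalgebra K" "K \<subseteq> Q"
    using QK quantum_pair_sub_superalgebra by (auto simp: quantum_pair_def)
  have "\<phi> v \<in> ind_space K" if \<phi>: "\<phi> \<in> QHom p" and v: "v \<in> carr W" for \<phi> :: "'w \<Rightarrow> ('m, 'n) uq \<Rightarrow> 'v" and v
  proof -
    have "graded_submodule Q M (\<phi> ` carr W)"
      using \<phi> by (rule QW.hom_image_submodule)
    moreover have "in_cat Q K (sub_mod M (\<phi> ` carr W))"
      using \<phi> W K uK_mem_quantum_pair[OF QK] by (rule QW.in_cat_hom_image)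
    ultimately show ?thesis
      using v by (intro H.hom.span_base) blast
  qed
  then show "hom_gr Q W (ind Q K P V) p = QHom p"
    unfolding ind_eq hom_gr_def by (auto simp: image_subset_iff W.gr.gtotal_mem)
qed

text \<open>Used to compute \<open>ind_map\<close> after \<open>\<phi>\<close>:
  \<open>ind_map\<close> is set to 0 outside the carrier of the induced module, so the values of
  \<open>\<phi>\<close> must be placed inside it.\<close>

lemma QHom_ind_carr:
  assumes "\<phi> \<in> gtotal (hom_gr Q W (ind Q K P V))"
  shows "\<phi> w \<in> carr (ind Q K P V)"
proof -
  interpret I: graded_space "gr (ind Q K P V)"
    by (rule graded_space_ind)
  have homogeneous: "\<phi> w \<in> carr (ind Q K P V)" if \<phi>: "\<phi> \<in> hom_gr Q W (ind Q K P V) p" for \<phi> p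
  proof (cases "w \<in> carr W")
    case True
    then show ?thesis
    proof (induction w rule: W.gr.gtotal_induct)
      case (homogeneous k w)
      then show ?case
        using \<phi> by (intro I.gtotal_mem[of _ "p + k"]) (unfold hom_gr_def, blast)
    next
      case (add u w)
      then have "\<phi> (u + w) = \<phi> u + \<phi> w"
        using \<phi> by (auto simp: hom_gr_def)
      then show ?case
        using add by (simp only: I.gtotal_add)
    qed
  next
    case False
    then have "\<phi> w = 0" using \<phi> by (auto simp: hom_gr_def)
    then show ?thesis by (simp only: I.gtotal_zero)
  qed
  from assms show ?thesis
    by (rule gtotal_cases) (simp only: plus_fun_apply I.gtotal_add homogeneous)
qed

end

section \<open>Naturality: post-composition with an even homomorphism\<close>

locale coinduction_map = coinduction Q P V + V': coinduction Q P V'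
  for Q P :: "('m::finite, 'n::finite) uq set"
    and V :: "('m, 'n, 'v::ab_group_add) supermod"
    and V' :: "('m, 'n, 'v2::ab_group_add) supermod" +
  fixes g :: "'v \<Rightarrow> 'v2"
  assumes g: "g \<in> hom_gr P V V' 0"
begin

sublocale VV: supermodule_pair P V V'
  by (intro supermodule_pairI P.sub_superalgebra_axioms V.supermodule_axioms V'.V.supermodule_axioms)

lemma g_ksign: "v \<in> carr V \<Longrightarrow> g (ksign p v) = ksign p (g v)"
  by (simp add: ksign_def VV.hom_uminus[OF g])

lemma comp_mem:
  assumes \<zeta>: "\<zeta> \<in> H k"
  shows "g \<circ> \<zeta> \<in> V'.H k"
proof (rule V'.H.hom_grI; (unfold R_simps Q.gtotal_eq)?)
  show "(g \<circ> \<zeta>) (u + v) = (g \<circ> \<zeta>) u + (g \<circ> \<zeta>) v" if "u \<in> Q" "v \<in> Q" for u v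
    using that H.hom_add[OF \<zeta>] VV.hom_add[OF g] H.hom_carr[OF \<zeta>] by simp
  show "(g \<circ> \<zeta>) (uq_scale c v) = smul V' c ((g \<circ> \<zeta>) v)" if "v \<in> Q \<inter> uq_gr j" for c v j
    using that H.hom_smul[OF \<zeta>] VV.hom_smul[OF g] H.hom_carr[OF \<zeta>] by simp
  show "(g \<circ> \<zeta>) v \<in> gr V' (k + j)" if "v \<in> Q \<inter> uq_gr j" for v j
    using VV.hom_homogeneous[OF g H.hom_homogeneous[OF \<zeta>, of v j]] that by simp
  show "(g \<circ> \<zeta>) (x * v) = ksign (i * k) (act V' x ((g \<circ> \<zeta>) v))"
    if "x \<in> P" "x \<in> uq_gr i" "v \<in> Q \<inter> uq_gr j" for x i v j
    using that H.hom_act[OF \<zeta> that(1,2), of v] VV.hom_act[OF g that(1,2), of "\<zeta> v"] H.hom_carr[OF \<zeta>]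
    by (simp add: g_ksign V.act_carr P.sub_superalgebra_axioms)
qed (use H.hom_outside[OF \<zeta>] VV.hom_zero[OF g] in simp)

text \<open>The action changes the argument of \<open>\<zeta>\<close> and \<open>g\<close> changes
  its value. Since \<open>g\<close> is even, the parity of \<open>\<zeta>\<close>, and with it the
  sign, is the same before and after composition.\<close>

lemma comp_act:
  assumes \<zeta>: "\<zeta> \<in> H k" and y: "y \<in> Q" "y \<in> uq_gr i"
  shows "g \<circ> act M y \<zeta> = act V'.M y (g \<circ> \<zeta>)"
proof (rule V'.fun_eq_on_Q)
  show "g \<circ> act M y \<zeta> \<in> gtotal V'.H"
    by (rule V'.H.hom.gtotal_mem[OF comp_mem[OF M_act_mem_homogeneous[OF y \<zeta>]]])
  show "act V'.M y (g \<circ> \<zeta>) \<in> gtotal V'.H"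
    by (rule V'.H.hom.gtotal_mem[OF V'.M_act_mem_homogeneous[OF y comp_mem[OF \<zeta>]]])
  show "(g \<circ> act M y \<zeta>) x = act V'.M y (g \<circ> \<zeta>) x" if "x \<in> Q" "x \<in> uq_gr j" for x j
    using M_act_homogeneous[OF y that \<zeta>] V'.M_act_homogeneous[OF y that comp_mem[OF \<zeta>]]
    by (simp add: g_ksign H.hom_carr[OF \<zeta>])
qed

lemma comp_plus:
  assumes "\<zeta> \<in> gtotal H" "\<zeta>' \<in> gtotal H"
  shows "g \<circ> (\<zeta> + \<zeta>') = (g \<circ> \<zeta>) + (g \<circ> \<zeta>')"
  using assms by (simp add: fun_eq_iff VV.hom_add[OF g] H.gtotal_hom_carr)

text \<open>Stated for the full coinduced modules; \<open>hom_gr_ind\<close> transfers it to the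
  induced ones. The even maps \<open>f\<close> and \<open>g\<close> add no signs, so the composite
  has the parity of \<open>\<phi>\<close>.\<close>

lemma comp_hom:
  assumes "supermodule Q W" "supermodule Q W'"
    and \<phi>: "\<phi> \<in> hom_gr Q W M p" and f: "f \<in> hom_gr Q W' W 0"
  shows "(\<lambda>w. g \<circ> \<phi> (f w)) \<in> hom_gr Q W' V'.M p"
proof -
  interpret rec: reciprocity Q P V W
    by (intro reciprocity.intro coinduction_axioms assms)
  interpret rec': reciprocity Q P V' W'
    by (intro reciprocity.intro V'.coinduction_axioms assms)
  interpret WW: supermodule_pair Q W' W
    by (intro supermodule_pairI Q.sub_superalgebra_axioms assms)
  have carr: "f w \<in> carr W" "\<phi> w' \<in> gtotal H" for w w'
    using WW.hom_carr[OF f] rec.QW.hom_carr[OF \<phi>] by auto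
  show ?thesis
  proof (rule rec'.QW.hom_grI)
    show "g \<circ> \<phi> (f (u + v)) = (g \<circ> \<phi> (f u)) + (g \<circ> \<phi> (f v))" if "u \<in> carr W'" "v \<in> carr W'" for u v
      using that by (simp only: WW.hom_add[OF f] rec.QW.hom_add[OF \<phi>] carr comp_plus)
    show "g \<circ> \<phi> (f (smul W' c v)) = smul V'.M c (g \<circ> \<phi> (f v))" if "v \<in> gr W' j" for c v j
      using WW.hom_smul[OF f rec'.W.gr.gtotal_mem[OF that]] rec.QW.hom_smul[OF \<phi> carr(1)] carr(2)
      by (simp add: fun_eq_iff hom_smul_def VV.hom_smul[OF g] H.gtotal_hom_carr)
    show "g \<circ> \<phi> (f v) \<in> gr V'.M (p + j)" if "v \<in> gr W' j" for v j
      using comp_mem[OF rec.QHom_value[OF \<phi> WW.hom_homogeneous[OF f that]]] by simp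
    show "g \<circ> \<phi> (f (act W' x v)) = ksign (i * p) (act V'.M x (g \<circ> \<phi> (f v)))"
      if x: "x \<in> Q" "x \<in> uq_gr i" and v: "v \<in> gr W' j" for x i v j
    proof -
      have "f (act W' x v) = act W x (f v)"
        using WW.hom_act[OF f x rec'.W.gr.gtotal_mem[OF v]] by simp
      then have "\<phi> (f (act W' x v)) = ksign (i * p) (act M x (\<phi> (f v)))"
        using rec.QW.hom_act[OF \<phi> x carr(1)] by simp
      moreover have "g \<circ> act M x (\<phi> (f v)) = act V'.M x (g \<circ> \<phi> (f v))"
        using rec.QHom_value[OF \<phi> WW.hom_homogeneous[OF f v]] x by (rule comp_act)
      \<comment> \<open>\<open>g\<close> is known to respect negation only on the carrier of
        \<open>V\<close>, where the values of \<open>\<zeta>\<close> lie.\<close>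
      moreover have "g \<circ> ksign (i * p) \<zeta> = ksign (i * p) (g \<circ> \<zeta>)" if "\<zeta> \<in> gtotal H" for \<zeta>
        using H.gtotal_hom_carr[OF that] by (simp add: fun_eq_iff ksign_apply g_ksign)
      ultimately show ?thesis
        using M_act_mem[OF x(1) carr(2)] by simp
    qed
    show "g \<circ> \<phi> (f v) = 0" if "v \<notin> carr W'" for v
      using WW.hom_outside[OF f that] rec.QW.hom_zero[OF \<phi>] VV.hom_zero[OF g]
      by (simp add: fun_eq_iff)
  qed
qed

end

text \<open>Both ways around the naturality square send \<open>w\<close> to \<open>g\<close> of the
  value of \<open>\<phi> (f w)\<close> at 1. The content lies in the composite being again a
  homomorphism into the induced module.\<close>

theorem theorem4p1:
  fixes Q K P L :: "('m::finite, 'n::finite) uq set"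
    and W :: "('m, 'n, 'w::ab_group_add) supermod"
    and V :: "('m, 'n, 'v::ab_group_add) supermod"
  assumes compatible: "compatible_pairs Q K P L"
    and W: "in_cat Q K W"
    and V: "in_cat P L V"
  shows "even_iso
           (hom_smul (ind Q K P V)) (hom_gr Q W (ind Q K P V))
           (hom_smul V) (hom_gr P (forget P W) V)
           eval_one
    \<and> (\<forall>(W' :: ('m, 'n, 'w2::ab_group_add) supermod) (V' :: ('m, 'n, 'v2::ab_group_add) supermod) f g.
         in_cat Q K W' \<longrightarrow> in_cat P L V' \<longrightarrow> f \<in> hom_gr Q W' W 0 \<longrightarrow> g \<in> hom_gr P V V' 0 \<longrightarrow>
         (\<forall>\<phi> \<in> gtotal (hom_gr Q W (ind Q K P V)).
            ind_map Q K P V g \<circ> \<phi> \<circ> f \<in> gtotal (hom_gr Q W' (ind Q K P V')) \<and>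
            eval_one (ind_map Q K P V g \<circ> \<phi> \<circ> f) = g \<circ> eval_one \<phi> \<circ> f))"
proof (intro conjI allI impI ballI)
  have QK: "quantum_pair Q K" and PL: "quantum_pair P L" and "P \<subseteq> Q"
    using compatible by (auto simp: compatible_pairs_def)
  have sub: "sub_superalgebra Q" "sub_superalgebra P"
    using quantum_pair_sub_superalgebra QK PL by blast+
  have mod: "supermodule Q W" "supermodule P V"
    using W V by (auto simp: in_cat_def)
  interpret rec: reciprocity Q P V W
    by (intro reciprocity.intro coinduction.intro coinduction_axioms.intro sub mod \<open>P \<subseteq> Q\<close>)
  \<comment> \<open>This identification turns the claim into reciprocity for the full coinduced
    module.\<close>
  note ind = rec.hom_gr_ind[OF W QK]
  have smul: "hom_smul (ind Q K P V) = (hom_smul rec.M :: cq \<Rightarrow> ('w \<Rightarrow> _) \<Rightarrow> _)"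
    by (simp add: fun_eq_iff hom_smul_def rec.ind_eq)
  show "even_iso (hom_smul (ind Q K P V)) (hom_gr Q W (ind Q K P V))
      (hom_smul V) (hom_gr P (forget P W) V) eval_one"
    unfolding ind smul by (rule rec.even_iso_eval_one)
  fix W' :: "('m, 'n, 'w2) supermod" and V' :: "('m, 'n, 'v2) supermod" and f g \<phi>
  assume W': "in_cat Q K W'" and V': "in_cat P L V'" and f: "f \<in> hom_gr Q W' W 0"
    and g: "g \<in> hom_gr P V V' 0" and \<phi>: "\<phi> \<in> gtotal (hom_gr Q W (ind Q K P V))"
  have mod': "supermodule Q W'" "supermodule P V'"
    using W' V' by (auto simp: in_cat_def)
  interpret rec': reciprocity Q P V' W'
    by (intro reciprocity.intro coinduction.intro coinduction_axioms.intro sub mod' \<open>P \<subseteq> Q\<close>)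
  interpret coinduction_map Q P V V' g
    by (intro coinduction_map.intro coinduction_map_axioms.intro rec.coinduction_axioms
        rec'.coinduction_axioms g)
  \<comment> \<open>All values of \<open>\<phi>\<close> lie in the induced module, so the default
    value of \<open>ind_map\<close> is never taken and plain post-composition remains.\<close>
  have comp: "ind_map Q K P V g \<circ> \<phi> \<circ> f = (\<lambda>w. g \<circ> \<phi> (f w))"
    using rec.QHom_ind_carr[OF \<phi>] by (simp add: ind_map_def fun_eq_iff)
  show "eval_one (ind_map Q K P V g \<circ> \<phi> \<circ> f) = g \<circ> eval_one \<phi> \<circ> f"
    unfolding comp by (simp add: eval_one_def fun_eq_iff)
  \<comment> \<open>\<open>comp_hom\<close> applies to a fixed parity, so \<open>\<phi>\<close> is
    split and the two composites are added.\<close>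
  obtain \<alpha> \<beta> where \<alpha>\<beta>: "\<alpha> \<in> rec.QHom 0" "\<beta> \<in> rec.QHom 1" and sum: "\<phi> = \<alpha> + \<beta>"
    using \<phi> unfolding ind by (rule gtotal_cases)
  have "g \<circ> (\<alpha> w + \<beta> w) = (g \<circ> \<alpha> w) + (g \<circ> \<beta> w)" for w
    using rec.QW.hom_carr[OF \<alpha>\<beta>(1)] rec.QW.hom_carr[OF \<alpha>\<beta>(2)] by (intro comp_plus) simp_all
  then have "(\<lambda>w. g \<circ> \<phi> (f w)) = (\<lambda>w. g \<circ> \<alpha> (f w)) + (\<lambda>w. g \<circ> \<beta> (f w))"
    unfolding sum by (simp add: fun_eq_iff)
  also have "\<dots> \<in> gtotal rec'.QHom"
    using comp_hom[OF mod(1) mod'(1) \<alpha>\<beta>(1) f] comp_hom[OF mod(1) mod'(1) \<alpha>\<beta>(2) f]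
    by (intro rec'.QW.hom.gtotal_add rec'.QW.hom.gtotal_mem)
  finally show "ind_map Q K P V g \<circ> \<phi> \<circ> f \<in> gtotal (hom_gr Q W' (ind Q K P V'))"
    unfolding comp rec'.hom_gr_ind[OF W' QK] .
qed

end
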